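(* Let $S\in\mathcal G$ be a geometric action, let the two sets $A_1,A_2\subset\tilde D$ be closed in $D$, and suppose that there exists a compact set $K\subset\tilde D$ such that the minimization problem $P(A_1,A_2)$ has a minimizing sequence $(\gamma_n)_{n\in\mathbb N}$ with $\gamma_n\subset K$ for all $n\in\mathbb N$ and with $\sup_{n\in\mathbb N}\operatorname{length}(\gamma_n)<\infty$. Then $P(A_1,A_2)$ has a strong minimizer $\gamma^\star$ fulfilling $\operatorname{length}(\gamma^\star)\le\liminf_{n\to\infty}\operatorname{length}(\gamma_n)$.
   Context: $D\subseteq\mathbb R^n$ is open and connected; $\tilde D\subseteq D$ is connected and closed in $D$. Curves. An unparameterized oriented curve in $D$ is an equivalence class of functions $\varphi\in C([0,T],D)$, $T>0$, that are identical up to continuous non-decreasing changes of parameterization (their Fréchet distance vanishes); the representatives are its parameterizations. $\gamma\subset G$ means that the image of $\gamma$ lies in $G$. $\Gamma$ is the set of rectifiable curves (finite Euclidean length). $\tilde C(0,1)$ is the set of $\varphi\in C([0,1],D)$ that are absolutely continuous in neighborhoods of all but at most finitely many $\alpha_i\in[0,1]$, and $\tilde\Gamma\supset\Gamma$ is the set of curves that can be parameterized by some $\varphi\in\tilde C(0,1)$. For $A_1,A_2\subset\tilde D$, $\Gamma_{A_1}^{A_2}$ (resp. $\tilde\Gamma_{A_1}^{A_2}$) is the set of $\gamma\in\Gamma$ (resp. $\gamma\in\tilde\Gamma$) with $\gamma\subset\tilde D$ that start in $A_1$ and end in $A_2$; $\Gamma_{x_1}^{x_2}:=\Gamma_{\{x_1\}}^{\{x_2\}}$.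 Standing assumption on $\tilde D$: $\forall x\in\tilde D\ \forall\nu>0\ \exists r>0\ \forall w\in\bar B_r(x)\cap\tilde D\ \exists\gamma\in\Gamma_x^w$ with $\operatorname{length}(\gamma)\le\nu$. Geometric actions. $\mathcal G$ is the set of functionals $S\colon\tilde\Gamma\to[0,\infty]$ of the form $S(\gamma)=\int_0^1\ell(\varphi,\varphi')\,d\alpha$, where $\varphi\in\tilde C(0,1)$ is an arbitrary parameterization of $\gamma$ and $\ell\in C(D\times\mathbb R^n,[0,\infty))$ satisfies: (i) $\ell(x,cy)=c\,\ell(x,y)$ for all $x\in D$, $y\in\mathbb R^n$, $c\ge0$; (ii) for every $x\in D$ the function $\ell(x,\cdot)$ is convex. (The value does not depend on the choice of $\varphi$.) $P(A_1,A_2)$ denotes the minimization problem $\inf_{\gamma\in\Gamma_{A_1}^{A_2}}S(\gamma)$. A minimizing sequence is a sequence $(\gamma_n)\subset\Gamma_{A_1}^{A_2}$ with $S(\gamma_n)\to\inf_{\gamma\in\Gamma_{A_1}^{A_2}}S(\gamma)$. A strong minimizer is $\gamma^\star\in\Gamma_{A_1}^{A_2}$ with $S(\gamma^\star)=\inf_{\gamma\in\Gamma_{A_1}^{A_2}}S(\gamma)$. *)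

theory Defs
  imports "HOL-Analysis.Analysis"
begin

section \<open>Unparameterized oriented curves\<close>

text \<open>
  A parameterized curve is a pair \<open>(T, \<phi>)\<close>, where only the values of the total function
  \<open>\<phi>\<close> on \<open>[0, T]\<close> matter.  In particular the equivalence below identifies functions that
  agree on \<open>[0, T]\<close>.
\<close>

type_synonym 'n param = "real \<times> (real \<Rightarrow> real ^ 'n)"
type_synonym 'n curve = "'n param set"

definition params :: "(real ^ 'n) set \<Rightarrow> 'n param set" where
  "params D = {(T, \<phi>). 0 < T \<and> continuous_on {0..T} \<phi> \<and> \<phi> ` {0..T} \<subseteq> D}"

definition reparams :: "real \<Rightarrow> (real \<Rightarrow> real) set" where
  "reparams T = {a. continuous_on {0..1} a \<and> mono_on {0..1} a \<and> a ` {0..1} = {0..T}}"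

definition frechet_dist :: "'n::finite param \<Rightarrow> 'n param \<Rightarrow> real" where
  "frechet_dist p q =
     (INF (a, b) \<in> reparams (fst p) \<times> reparams (fst q).
        SUP t\<in>{0..1}. dist (snd p (a t)) (snd q (b t)))"

definition frechet_equiv :: "(real ^ 'n::finite) set \<Rightarrow> ('n param \<times> 'n param) set" where
  "frechet_equiv D = {(p, q). p \<in> params D \<and> q \<in> params D \<and> frechet_dist p q = 0}"

definition curves :: "(real ^ 'n::finite) set \<Rightarrow> 'n curve set" where
  "curves D = params D // frechet_equiv D"

definition param_length :: "'n::finite param \<Rightarrow> ennreal" where
  "param_length p =
     (SUP (t, N) \<in> {t. mono t \<and> range t \<subseteq> {0..fst p}} \<times> (UNIV :: nat set).
        ennreal (\<Sum>i<N. dist (snd p (t i)) (snd p (t (Suc i)))))"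

text \<open>
  Start, end and length of a curve are the common values for all its parameterizations;
  lemma \<open>curve_eqs\<close> below shows that these exist.
\<close>

definition curve_start :: "'n::finite curve \<Rightarrow> real ^ 'n" where
  "curve_start \<gamma> = (THE x. \<forall>(T, \<phi>)\<in>\<gamma>. \<phi> 0 = x)"

definition curve_end :: "'n::finite curve \<Rightarrow> real ^ 'n" where
  "curve_end \<gamma> = (THE x. \<forall>(T, \<phi>)\<in>\<gamma>. \<phi> T = x)"

definition curve_length :: "'n::finite curve \<Rightarrow> ennreal" where
  "curve_length \<gamma> = (THE L. \<forall>p\<in>\<gamma>. param_length p = L)"

definition curve_image :: "'n::finite curve \<Rightarrow> (real ^ 'n) set" where
  "curve_image \<gamma> = (\<Union>(T, \<phi>)\<in>\<gamma>. \<phi> ` {0..T})"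


subsection \<open>Well-definedness\<close>

lemma reparams_scale: "0 < T \<Longrightarrow> (\<lambda>t. T * t) \<in> reparams T"
  by (auto simp: reparams_def mono_on_def image_mult_atLeastAtMost intro!: continuous_intros)

lemma reparams_ends:
  assumes "a \<in> reparams T" "0 < T"
  shows "a 0 = 0" "a 1 = T"
proof -
  have im: "a ` {0..1} = {0..T}" and m: "mono_on {0..1} a"
    using assms by (auto simp: reparams_def)
  have "0 \<in> a ` {0..1}" "T \<in> a ` {0..1}" using im assms(2) by auto
  then obtain u v where u: "u \<in> {0..1}" "a u = 0" and v: "v \<in> {0..1}" "a v = T"
    unfolding image_iff by metis
  have "a 0 \<le> a u" "a v \<le> a 1" using mono_onD[OF m, of 0 u] mono_onD[OF m, of v 1] u(1) v(1) by auto
  moreover have "a 0 \<in> {0..T}" "a 1 \<in> {0..T}" unfolding im[symmetric] by auto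
  ultimately show "a 0 = 0" "a 1 = T" using u v by auto
qed

lemma frechet_dist_0_iff:
  assumes p: "p \<in> params D" and q: "q \<in> params D"
  shows "frechet_dist p q = 0 \<longleftrightarrow>
    (\<forall>e>0. \<exists>a\<in>reparams (fst p). \<exists>b\<in>reparams (fst q).
       \<forall>t\<in>{0..1}. dist (snd p (a t)) (snd q (b t)) < e)" (is "_ \<longleftrightarrow> ?R")
proof -
  define R where "R = reparams (fst p) \<times> reparams (fst q)"
  define s where "s = (\<lambda>(a, b). SUP t\<in>{0..1::real}. dist (snd p (a t)) (snd q (b t)))"
  have fd: "frechet_dist p q = (INF ab\<in>R. s ab)"
    unfolding frechet_dist_def R_def s_def by (simp add: case_prod_unfold)
  have R0: "R \<noteq> {}"
    using p q reparams_scale[of "fst p"] reparams_scale[of "fst q"]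
    unfolding R_def params_def by (auto simp: case_prod_unfold)
  have cont: "continuous_on {0..1} (\<lambda>t. dist (snd p (a t)) (snd q (b t)))"
    if "(a, b) \<in> R" for a b
  proof -
    have "continuous_on {0..1} (snd p \<circ> a)" "continuous_on {0..1} (snd q \<circ> b)"
      using that p q unfolding R_def reparams_def params_def
      by (intro continuous_on_compose; simp add: case_prod_unfold)+
    then show ?thesis by (auto simp: o_def intro!: continuous_intros)
  qed
  have bdd: "bdd_above ((\<lambda>t. dist (snd p (a t)) (snd q (b t))) ` {0..1})"
    if "(a, b) \<in> R" for a b
    using compact_continuous_image[OF cont[OF that]]
    by (simp add: compact_imp_bounded bounded_imp_bdd_above)
  have upper: "dist (snd p (a t)) (snd q (b t)) \<le> s (a, b)"
    if "(a, b) \<in> R" "t \<in> {0..1}" for a b t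
    unfolding s_def using cSUP_upper[OF that(2) bdd[OF that(1)]] by simp
  have s0: "0 \<le> s ab" if "ab \<in> R" for ab
    using upper[of "fst ab" "snd ab" 0] that
      order_trans[OF zero_le_dist[of "snd p (fst ab 0)" "snd q (snd ab 0)"]] by simp
  have bb: "bdd_below (s ` R)" using s0 by (intro bdd_belowI2[of _ 0])
  show ?thesis
  proof
    assume "frechet_dist p q = 0"
    show ?R
    proof (intro allI impI)
      fix e :: real assume "e > 0"
      then have "(INF ab\<in>R. s ab) < e" using fd \<open>frechet_dist p q = 0\<close> by simp
      then obtain a b where ab: "(a, b) \<in> R" "s (a, b) < e"
        using cINF_less_iff[OF R0 bb] by auto
      then have "dist (snd p (a t)) (snd q (b t)) < e" if "t \<in> {0..1}" for t
        using upper[OF ab(1) that] by simp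
      then show "\<exists>a\<in>reparams (fst p). \<exists>b\<in>reparams (fst q).
          \<forall>t\<in>{0..1}. dist (snd p (a t)) (snd q (b t)) < e"
        using ab(1) unfolding R_def by blast
    qed
  next
    assume r: ?R
    have "(INF ab\<in>R. s ab) \<le> e" if e: "e > 0" for e
    proof -
      obtain a b where ab: "(a, b) \<in> R" "\<And>t. t\<in>{0..1} \<Longrightarrow> dist (snd p (a t)) (snd q (b t)) < e"
        using r[rule_format, OF e] unfolding R_def by auto
      have "(SUP t\<in>{0..1}. dist (snd p (a t)) (snd q (b t))) \<le> e"
        by (rule cSUP_least) (simp, rule less_imp_le[OF ab(2)])
      then have "s (a, b) \<le> e" by (simp add: s_def)
      then show ?thesis using cINF_lower2[OF bb ab(1)] by blast
    qed
    then have "(INF ab\<in>R. s ab) \<le> 0" by (rule dense_ge)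
    moreover have "0 \<le> (INF ab\<in>R. s ab)" using R0 s0 by (rule cINF_greatest)
    ultimately show "frechet_dist p q = 0" using fd by simp
  qed
qed

lemma frechet_equivD:
  assumes "(p, q) \<in> frechet_equiv D" "e > 0"
  obtains a b where "a \<in> reparams (fst p)" "b \<in> reparams (fst q)"
    "\<And>t. t \<in> {0..1} \<Longrightarrow> dist (snd p (a t)) (snd q (b t)) < e"
  using assms frechet_dist_0_iff[of p D q] unfolding frechet_equiv_def by blast

lemma reparams_compose:
  assumes "a \<in> reparams T" "c \<in> reparams 1"
  shows "a \<circ> c \<in> reparams T"
proof -
  have c: "c ` {0..1} = {0..1}" using assms by (auto simp: reparams_def)
  then have "c t \<in> {0..1}" if "t \<in> {0..1}" for t using that by blast
  moreover have "(a \<circ> c) ` {0..1} = {0..T}"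
    using assms c unfolding reparams_def image_comp[symmetric] by simp
  moreover have "continuous_on {0..1} (a \<circ> c)"
    using assms c by (intro continuous_on_compose) (simp_all add: reparams_def)
  ultimately show ?thesis using assms
    by (auto simp: reparams_def mono_on_def)
qed

lemma reparams_factor:
  assumes b: "b \<in> reparams T" and a: "a \<in> reparams T" and T: "0 < T" and d: "0 < d"
  obtains c where "c \<in> reparams 1" "\<And>t. t \<in> {0..1} \<Longrightarrow> dist (b (c t)) (a t) < d"
proof -
  define h where "h = min (1/2) (d / (2 * T))"
  have h: "0 < h" "h < 1" "h * T < d"
    using T d by (auto simp: h_def min_def field_simps)
  define b' where "b' = (\<lambda>t. (1 - h) * b t + h * (T * t))"
  have bc: "continuous_on {0..1} b" "mono_on {0..1} b" "b ` {0..1} = {0..T}"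
    and ac: "continuous_on {0..1} a" "mono_on {0..1} a" "a ` {0..1} = {0..T}"
    using a b by (auto simp: reparams_def)
  note be = reparams_ends[OF b T] and ae = reparams_ends[OF a T]
  have c': "continuous_on {0..1} b'" unfolding b'_def by (intro continuous_intros bc)
  have sm: "b' s < b' t" if "s \<in> {0..1}" "t \<in> {0..1}" "s < t" for s t
  proof -
    have "b s \<le> b t" using bc(2) that by (auto simp: mono_on_def)
    then show ?thesis unfolding b'_def using h T that
      by (intro add_le_less_mono mult_left_mono mult_strict_left_mono) auto
  qed
  have e': "b' 0 = 0" "b' 1 = T" using be by (auto simp: b'_def algebra_simps)
  have inj: "inj_on b' {0..1}" using sm by (intro linorder_inj_onI) force+
  have im: "b' ` {0..1} = {0..T}"
  proof (rule antisym)
    show "b' ` {0..1} \<subseteq> {0..T}"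
    proof clarsimp
      fix t :: real assume "0 \<le> t" "t \<le> 1"
      then show "0 \<le> b' t \<and> b' t \<le> T" using sm[of 0 t] sm[of t 1] e' T
        by (cases "t = 0"; cases "t = 1") auto
    qed
    show "{0..T} \<subseteq> b' ` {0..1}"
    proof
      fix y assume "y \<in> {0..T}"
      then show "y \<in> b' ` {0..1}" using IVT'[of b' 0 y 1] c' e' by auto
    qed
  qed
  define c where "c = the_inv_into {0..1} b' \<circ> a"
  have bca: "b' (c t) = a t" and cin: "c t \<in> {0..1}" if "t \<in> {0..1}" for t
  proof -
    have "a t \<in> b' ` {0..1}" using im ac(3) that by blast
    then show "b' (c t) = a t" "c t \<in> {0..1}"
      using f_the_inv_into_f[OF inj] the_inv_into_into[OF inj _ subset_refl] by (auto simp: c_def)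
  qed
  have "continuous_on {0..T} (the_inv_into {0..1} b')"
    using continuous_on_inv_into[OF c' _ inj] im by simp
  then have "continuous_on {0..1} c" unfolding c_def using ac
    by (intro continuous_on_compose) auto
  moreover have "mono_on {0..1} c"
  proof (rule mono_onI)
    fix s t :: real assume st: "s \<in> {0..1}" "t \<in> {0..1}" "s \<le> t"
    then have "a s \<le> a t" using ac(2) by (auto simp: mono_on_def)
    then show "c s \<le> c t" using sm[OF cin cin, of t s] bca st by force
  qed
  moreover have "c ` {0..1} = {0..1}"
  proof -
    have "c ` {0..1} = the_inv_into {0..1} b' ` (b' ` {0..1})"
      unfolding c_def image_comp[symmetric] using ac im by simp
    also have "\<dots> = {0..1}" using inj by (rule the_inv_into_onto)
    finally show ?thesis .
  qed
  ultimately have "c \<in> reparams 1" by (simp add: reparams_def)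
  moreover have "dist (b (c t)) (a t) < d" if "t \<in> {0..1}" for t
  proof -
    have ct: "c t \<in> {0..1}" using cin that .
    then have "b (c t) \<in> {0..T}" using bc by blast
    moreover have "T * c t \<in> {0..T}" using ct T by (auto simp: mult_left_le)
    ultimately have "\<bar>b (c t) - T * c t\<bar> \<le> T" by auto
    moreover have "b (c t) - a t = h * (b (c t) - T * c t)"
      using bca[OF that] by (simp add: b'_def algebra_simps)
    ultimately have "dist (b (c t)) (a t) \<le> h * T"
      using h by (simp add: dist_real_def abs_mult)
    then show ?thesis using h by simp
  qed
  ultimately show ?thesis using that by blast
qed

lemma equiv_frechet_equiv: "equiv (params D) (frechet_equiv D)"
proof (rule equivI)
  show "frechet_equiv D \<subseteq> params D \<times> params D" by (auto simp: frechet_equiv_def)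
  show "refl_on (params D) (frechet_equiv D)"
  proof (rule refl_onI)
    fix p assume p: "p \<in> params D"
    then have "(\<lambda>t. fst p * t) \<in> reparams (fst p)"
      by (intro reparams_scale) (auto simp: params_def)
    then have "frechet_dist p p = 0" unfolding frechet_dist_0_iff[OF p p] by force
    then show "(p, p) \<in> frechet_equiv D" using p by (simp add: frechet_equiv_def)
  qed
  show "sym (frechet_equiv D)"
  proof (rule symI)
    fix p q assume pq: "(p, q) \<in> frechet_equiv D"
    then have m: "p \<in> params D" "q \<in> params D" by (auto simp: frechet_equiv_def)
    have "frechet_dist q p = 0" unfolding frechet_dist_0_iff[OF m(2,1)]
      using frechet_equivD[OF pq] by (metis dist_commute)
    then show "(q, p) \<in> frechet_equiv D" using m by (simp add: frechet_equiv_def)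
  qed
  show "trans (frechet_equiv D)"
  proof (rule transI)
    fix p q r assume pq: "(p, q) \<in> frechet_equiv D" and qr: "(q, r) \<in> frechet_equiv D"
    then have m: "p \<in> params D" "q \<in> params D" "r \<in> params D" by (auto simp: frechet_equiv_def)
    have "frechet_dist p r = 0" unfolding frechet_dist_0_iff[OF m(1,3)]
    proof (intro allI impI)
      fix e :: real assume e: "e > 0"
      then have e3: "e / 3 > 0" by simp
      obtain a1 b1 where 1: "a1 \<in> reparams (fst p)" "b1 \<in> reparams (fst q)"
        "\<And>t. t \<in> {0..1} \<Longrightarrow> dist (snd p (a1 t)) (snd q (b1 t)) < e / 3"
        using frechet_equivD[OF pq e3] by blast
      obtain a2 b2 where 2: "a2 \<in> reparams (fst q)" "b2 \<in> reparams (fst r)"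
        "\<And>t. t \<in> {0..1} \<Longrightarrow> dist (snd q (a2 t)) (snd r (b2 t)) < e / 3"
        using frechet_equivD[OF qr e3] by blast
      have T: "0 < fst q" and "continuous_on {0..fst q} (snd q)"
        using m by (auto simp: params_def)
      then have "uniformly_continuous_on {0..fst q} (snd q)"
        by (intro compact_uniformly_continuous) auto
      then obtain d where d: "d > 0"
        "\<And>x y. x \<in> {0..fst q} \<Longrightarrow> y \<in> {0..fst q} \<Longrightarrow> dist x y < d \<Longrightarrow> dist (snd q x) (snd q y) < e / 3"
        using e3 unfolding uniformly_continuous_on_def by (metis dist_commute)
      obtain c where c: "c \<in> reparams 1" "\<And>t. t \<in> {0..1} \<Longrightarrow> dist (b1 (c t)) (a2 t) < d"
        using reparams_factor[OF 1(2) 2(1) T d(1)] by blast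
      have "dist (snd p ((a1 \<circ> c) t)) (snd r (b2 t)) < e" if t: "t \<in> {0..1}" for t
      proof -
        have ct: "c t \<in> {0..1}" using c(1) t by (auto simp: reparams_def)
        then have "b1 (c t) \<in> {0..fst q}" "a2 t \<in> {0..fst q}"
          using 1(2) 2(1) t by (auto simp: reparams_def)
        then have "dist (snd q (b1 (c t))) (snd q (a2 t)) < e / 3" using d(2) c(2) t by blast
        then show ?thesis using 1(3)[OF ct] 2(3)[OF t]
          by (simp add: o_def) (smt (verit) dist_triangle field_sum_of_halves)
      qed
      then show "\<exists>a\<in>reparams (fst p). \<exists>b\<in>reparams (fst r).
          \<forall>t\<in>{0..1}. dist (snd p (a t)) (snd r (b t)) < e"
        using reparams_compose[OF 1(1) c(1)] 2(2) by blast
    qed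
    then show "(p, r) \<in> frechet_equiv D" using m by (simp add: frechet_equiv_def)
  qed
qed

lemma frechet_equiv_ends:
  assumes "((T, \<phi>), (T', \<psi>)) \<in> frechet_equiv D"
  shows "\<phi> 0 = \<psi> 0" "\<phi> T = \<psi> T'"
proof -
  have T: "0 < T" "0 < T'" using assms by (auto simp: frechet_equiv_def params_def)
  have "dist (\<phi> 0) (\<psi> 0) < e \<and> dist (\<phi> T) (\<psi> T') < e" if e: "e > 0" for e
  proof -
    obtain a b where ab: "a \<in> reparams T" "b \<in> reparams T'"
      "\<And>t. t \<in> {0..1} \<Longrightarrow> dist (\<phi> (a t)) (\<psi> (b t)) < e"
      using frechet_equivD[OF assms e] by auto
    show ?thesis using ab(3)[of 0] ab(3)[of 1] reparams_ends[OF ab(1) T(1)]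
        reparams_ends[OF ab(2) T(2)] by auto
  qed
  then show "\<phi> 0 = \<psi> 0" "\<phi> T = \<psi> T'" by (metis dist_eq_0_iff less_irrefl zero_less_dist_iff)+
qed

lemma frechet_equiv_image:
  assumes "((T, \<phi>), (T', \<psi>)) \<in> frechet_equiv D"
  shows "\<phi> ` {0..T} \<subseteq> \<psi> ` {0..T'}"
proof clarify
  fix s assume s: "s \<in> {0..T}"
  have "continuous_on {0..T'} \<psi>" using assms by (auto simp: frechet_equiv_def params_def)
  then have cl: "closed (\<psi> ` {0..T'})"
    by (intro compact_imp_closed compact_continuous_image) auto
  have "\<exists>y\<in>\<psi> ` {0..T'}. dist y (\<phi> s) < e" if e: "e > 0" for e
  proof -
    obtain a b where ab: "a \<in> reparams T" "b \<in> reparams T'"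
      "\<And>t. t \<in> {0..1} \<Longrightarrow> dist (\<phi> (a t)) (\<psi> (b t)) < e"
      using frechet_equivD[OF assms e] by auto
    have "s \<in> a ` {0..1}" using ab(1) s by (simp add: reparams_def)
    then obtain t where "t \<in> {0..1}" "s = a t" by blast
    moreover from this have "b t \<in> {0..T'}" using ab(2) unfolding reparams_def by blast
    ultimately show ?thesis using ab(3)[of t]
      by (intro bexI[of _ "\<psi> (b t)"]) (simp add: dist_commute, rule imageI)
  qed
  then show "\<phi> s \<in> \<psi> ` {0..T'}" using cl closed_approachable by blast
qed

lemma frechet_equiv_length:
  assumes "(p, q) \<in> frechet_equiv D"
  shows "param_length p \<le> param_length q"
proof -
  have "ennreal (\<Sum>i<N. dist (snd p (t i)) (snd p (t (Suc i)))) \<le> param_length q"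
    if t: "mono t" "range t \<subseteq> {0..fst p}" for t N
  proof (rule ennreal_le_epsilon)
    fix e :: real assume e: "0 < e"
    define d where "d = e / (2 * (real N + 1))"
    have d: "d > 0" "2 * (real N * d) \<le> e" using e by (auto simp: d_def field_simps)
    obtain a b where ab: "a \<in> reparams (fst p)" "b \<in> reparams (fst q)"
      "\<And>t. t \<in> {0..1} \<Longrightarrow> dist (snd p (a t)) (snd q (b t)) < d"
      using frechet_equivD[OF assms d(1)] by auto
    define s where "s = (\<lambda>i. inv_into {0..1} a (t i))"
    have si: "s i \<in> {0..1}" "a (s i) = t i" for i
    proof -
      have "t i \<in> {0..fst p}" using t(2) by blast
      then have "t i \<in> a ` {0..1}" using ab(1) by (simp add: reparams_def)
      then show "s i \<in> {0..1}" "a (s i) = t i"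
        unfolding s_def by (auto intro: inv_into_into f_inv_into_f simp del: atLeastAtMost_iff)
    qed
    have "s i \<le> s j" if "i \<le> j" for i j
    proof (cases "t i = t j")
      case False
      then have "t i < t j" using t(1) that by (simp add: monoD order_less_le)
      moreover have "a (s j) \<le> a (s i)" if "s j \<le> s i"
        using ab(1) si(1) that by (auto simp: reparams_def mono_on_def)
      ultimately show ?thesis using si(2) by force
    qed (simp add: s_def)
    moreover have "b x \<le> b y" if "x \<in> {0..1}" "y \<in> {0..1}" "x \<le> y" for x y
      using ab(2) that by (auto simp: reparams_def mono_on_def)
    ultimately have "mono (\<lambda>i. b (s i))" using si(1) by (blast intro: monoI)
    moreover have "b (s i) \<in> {0..fst q}" for i using ab(2) si(1) unfolding reparams_def by blast
    ultimately have "((\<lambda>i. b (s i)), N) \<in> {t. mono t \<and> range t \<subseteq> {0..fst q}} \<times> UNIV"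
      by (auto simp del: atLeastAtMost_iff)
    then have *: "ennreal (\<Sum>i<N. dist (snd q (b (s i))) (snd q (b (s (Suc i))))) \<le> param_length q"
      unfolding param_length_def by (rule SUP_upper2) simp
    have "dist (snd p (t i)) (snd p (t (Suc i)))
      \<le> dist (snd q (b (s i))) (snd q (b (s (Suc i)))) + 2 * d" for i
    proof -
      have "dist (snd p (t i)) (snd q (b (s i))) < d"
        "dist (snd p (t (Suc i))) (snd q (b (s (Suc i)))) < d"
        using ab(3)[OF si(1)] si(2) by metis+
      then show ?thesis
        by (smt (verit) dist_commute dist_triangle2 dist_triangle)
    qed
    then have "(\<Sum>i<N. dist (snd p (t i)) (snd p (t (Suc i))))
      \<le> (\<Sum>i<N. dist (snd q (b (s i))) (snd q (b (s (Suc i)))) + 2 * d)" by (intro sum_mono) auto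
    also have "\<dots> \<le> (\<Sum>i<N. dist (snd q (b (s i))) (snd q (b (s (Suc i))))) + e"
      using d by (simp add: sum.distrib)
    finally have "ennreal (\<Sum>i<N. dist (snd p (t i)) (snd p (t (Suc i))))
      \<le> ennreal (\<Sum>i<N. dist (snd q (b (s i))) (snd q (b (s (Suc i))))) + ennreal e"
      using e by (subst ennreal_plus[symmetric]) (auto intro!: sum_nonneg ennreal_leI)
    also have "\<dots> \<le> param_length q + ennreal e" using * by (intro add_right_mono)
    finally show "ennreal (\<Sum>i<N. dist (snd p (t i)) (snd p (t (Suc i)))) \<le> param_length q + ennreal e" .
  qed
  then show ?thesis unfolding param_length_def[of p] by (intro SUP_least) auto
qed

lemma curve_eqs:
  assumes \<gamma>: "\<gamma> \<in> curves D" and p: "(T, \<phi>) \<in> \<gamma>"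
  shows "curve_start \<gamma> = \<phi> 0" "curve_end \<gamma> = \<phi> T"
    "curve_length \<gamma> = param_length (T, \<phi>)" "curve_image \<gamma> = \<phi> ` {0..T}"
proof -
  have eq: "(x, y) \<in> frechet_equiv D" if "x \<in> \<gamma>" "y \<in> \<gamma>" for x y
    using quotient_eqI[OF equiv_frechet_equiv] \<gamma> that equiv_frechet_equiv
    unfolding curves_def by (meson quotient_eq_iff)
  have e: "\<psi> 0 = \<phi> 0" "\<psi> T' = \<phi> T" "param_length (T', \<psi>) = param_length (T, \<phi>)"
    "\<psi> ` {0..T'} = \<phi> ` {0..T}" if "(T', \<psi>) \<in> \<gamma>" for T' \<psi>
    using frechet_equiv_ends[OF eq[OF that p]]
      frechet_equiv_length[OF eq[OF that p]] frechet_equiv_length[OF eq[OF p that]]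
      frechet_equiv_image[OF eq[OF that p]] frechet_equiv_image[OF eq[OF p that]]
    by auto
  show "curve_start \<gamma> = \<phi> 0" unfolding curve_start_def
  proof (rule the_equality)
    show "\<forall>(T', \<psi>)\<in>\<gamma>. \<psi> 0 = \<phi> 0" using e(1) by blast
    show "x = \<phi> 0" if "\<forall>(T', \<psi>)\<in>\<gamma>. \<psi> 0 = x" for x using bspec[OF that p] by simp
  qed
  show "curve_end \<gamma> = \<phi> T" unfolding curve_end_def
  proof (rule the_equality)
    show "\<forall>(T', \<psi>)\<in>\<gamma>. \<psi> T' = \<phi> T" using e(2) by blast
    show "x = \<phi> T" if "\<forall>(T', \<psi>)\<in>\<gamma>. \<psi> T' = x" for x using bspec[OF that p] by simp
  qed
  show "curve_length \<gamma> = param_length (T, \<phi>)" unfolding curve_length_def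
  proof (rule the_equality)
    show "\<forall>q\<in>\<gamma>. param_length q = param_length (T, \<phi>)" using e(3) by (metis surj_pair)
    show "x = param_length (T, \<phi>)" if "\<forall>q\<in>\<gamma>. param_length q = x" for x using bspec[OF that p] by simp
  qed
  show "curve_image \<gamma> = \<phi> ` {0..T}" unfolding curve_image_def
  proof (rule antisym)
    show "(\<Union>(T', \<psi>)\<in>\<gamma>. \<psi> ` {0..T'}) \<subseteq> \<phi> ` {0..T}" using e(4) by blast
    show "\<phi> ` {0..T} \<subseteq> (\<Union>(T', \<psi>)\<in>\<gamma>. \<psi> ` {0..T'})" using p by blast
  qed
qed


section \<open>Rectifiable and piecewise absolutely continuous curves\<close>

text \<open>
  The members of a division of a subset of the real line are nonempty compact intervals
  \<open>{Inf k..Sup k}\<close> with disjoint interiors.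
\<close>

definition abs_continuous_on :: "real set \<Rightarrow> (real \<Rightarrow> 'a::metric_space) \<Rightarrow> bool" where
  "abs_continuous_on I f \<longleftrightarrow>
     (\<forall>e>0. \<exists>d>0. \<forall>\<D>. \<D> division_of \<Union>\<D> \<and> \<Union>\<D> \<subseteq> I \<and> (\<Sum>k\<in>\<D>. Sup k - Inf k) < d \<longrightarrow>
        (\<Sum>k\<in>\<D>. dist (f (Inf k)) (f (Sup k))) < e)"

definition C_tilde :: "(real ^ 'n::finite) set \<Rightarrow> (real \<Rightarrow> real ^ 'n) set" where
  "C_tilde D = {\<phi>. continuous_on {0..1} \<phi> \<and> \<phi> ` {0..1} \<subseteq> D \<and>
     (\<exists>F. finite F \<and> F \<subseteq> {0..1} \<and>
        (\<forall>\<alpha>\<in>{0..1} - F. \<exists>r>0. abs_continuous_on (cball \<alpha> r \<inter> {0..1}) \<phi>))}"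

definition Gam :: "(real ^ 'n::finite) set \<Rightarrow> 'n curve set" where
  "Gam D = {\<gamma>\<in>curves D. curve_length \<gamma> < \<infinity>}"

definition Gam_tilde :: "(real ^ 'n::finite) set \<Rightarrow> 'n curve set" where
  "Gam_tilde D = {\<gamma>\<in>curves D. \<exists>\<phi>\<in>C_tilde D. (1, \<phi>) \<in> \<gamma>}"

definition Gam_from_to ::
    "(real ^ 'n::finite) set \<Rightarrow> (real ^ 'n) set \<Rightarrow> (real ^ 'n) set \<Rightarrow> (real ^ 'n) set \<Rightarrow> 'n curve set"
  where "Gam_from_to D D' A1 A2 =
    {\<gamma>\<in>Gam D. curve_image \<gamma> \<subseteq> D' \<and> curve_start \<gamma> \<in> A1 \<and> curve_end \<gamma> \<in> A2}"

definition locally_rectifiably_connected ::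
    "(real ^ 'n::finite) set \<Rightarrow> (real ^ 'n) set \<Rightarrow> bool" where
  "locally_rectifiably_connected D D' \<longleftrightarrow>
     (\<forall>x\<in>D'. \<forall>\<nu>>0. \<exists>r>0. \<forall>w\<in>cball x r \<inter> D'.
        \<exists>\<gamma>\<in>Gam_from_to D D' {x} {w}. curve_length \<gamma> \<le> ennreal \<nu>)"


section \<open>Geometric actions and minimization\<close>

definition geometric_integrand ::
    "(real ^ 'n::finite) set \<Rightarrow> (real ^ 'n \<Rightarrow> real ^ 'n \<Rightarrow> real) \<Rightarrow> bool" where
  "geometric_integrand D l \<longleftrightarrow>
     continuous_on (D \<times> UNIV) (\<lambda>(x, y). l x y) \<and>
     (\<forall>x\<in>D. \<forall>y. 0 \<le> l x y) \<and>
     (\<forall>x\<in>D. \<forall>y. \<forall>c\<ge>0. l x (c *\<^sub>R y) = c * l x y) \<and>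
     (\<forall>x\<in>D. convex_on UNIV (l x))"

text \<open>
  For \<open>\<phi>\<close> in \<open>C_tilde D\<close> the derivative exists almost everywhere on \<open>[0, 1]\<close>, so the
  unspecified value of \<open>vector_derivative\<close> at other points is irrelevant to the integral.
  Only the values of a functional on \<open>Gam_tilde D\<close> are constrained.
\<close>

definition geometric_action :: "(real ^ 'n::finite) set \<Rightarrow> ('n curve \<Rightarrow> ennreal) \<Rightarrow> bool" where
  "geometric_action D S \<longleftrightarrow>
     (\<exists>l. geometric_integrand D l \<and>
        (\<forall>\<gamma>\<in>Gam_tilde D. \<forall>\<phi>\<in>C_tilde D. (1, \<phi>) \<in> \<gamma> \<longrightarrow>
           S \<gamma> = (\<integral>\<^sup>+\<alpha>\<in>{0..1}. ennreal (l (\<phi> \<alpha>) (vector_derivative \<phi> (at \<alpha>))) \<partial>lebesgue)))"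

definition minimizing_sequence ::
    "'n::finite curve set \<Rightarrow> ('n curve \<Rightarrow> ennreal) \<Rightarrow> (nat \<Rightarrow> 'n curve) \<Rightarrow> bool" where
  "minimizing_sequence G S \<gamma> \<longleftrightarrow>
     (\<forall>n. \<gamma> n \<in> G) \<and> (\<lambda>n. S (\<gamma> n)) \<longlonglongrightarrow> (INF \<eta>\<in>G. S \<eta>)"

definition strong_minimizer ::
    "'n::finite curve set \<Rightarrow> ('n curve \<Rightarrow> ennreal) \<Rightarrow> 'n curve \<Rightarrow> bool" where
  "strong_minimizer G S \<gamma> \<longleftrightarrow> \<gamma> \<in> G \<and> S \<gamma> = (INF \<eta>\<in>G. S \<eta>)"

end

theory Submission
  imports Defs "HOL-Complex_Analysis.Great_Picard"
begin

text \<open>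
  The proof is the direct method of the calculus of variations.  A rectifiable curve has a
  parameterization on \<open>[0, 1]\<close> whose Lipschitz constant exceeds its length by as little as desired
  (\<open>rectifiable_curve_Lipschitz_param\<close>).  Along a subsequence on which the lengths tend to their
  limes inferior, such parameterizations of the minimizing sequence are equicontinuous and stay in
  the compact set \<open>K\<close>, so by Arzela-Ascoli they have a further subsequence converging to a curve
  whose Lipschitz constant, and hence whose length, is at most that limes inferior
  (\<open>Lipschitz_sequence_compactness\<close>).  End points and image behave well because
  \<open>A1\<close> and \<open>A2\<close> are closed in \<open>D\<close> and \<open>K\<close> is compact.

  It remains to see that the action is lower semicontinuous along this sequence
  (\<open>geometric_integral_lower_semicontinuous\<close>).  Weak convergence of the derivatives is not needed:
  the action is compared with the Riemann sums
  \<open>\<Sum>i<m. l (\<psi> (i / m)) (\<psi> ((i + 1) / m) - \<psi> (i / m))\<close>.  For a Lipschitz curve these converge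
  to the action as \<open>m\<close> tends to infinity, by dominated convergence and the almost everywhere
  differentiability of Lipschitz functions (\<open>polygonal_action_tendsto_integral\<close>).  By convexity and
  homogeneity \<open>l x\<close> is subadditive, so passing to a finer division cannot decrease the sums except
  for an error that is small uniformly in the curve (\<open>polygonal_action_refine\<close>).  Each sum of
  sufficiently high order is therefore, up to this error, a lower bound for the action that depends
  continuously on the curve, and the action is a limit of such lower bounds.

  One-variable differentiability of Lipschitz functions is derived from the Radon-Nikodym theorem
  and the Lebesgue differentiation theorem.
\<close>

section \<open>Differentiability of Lipschitz functions of one real variable\<close>

text \<open>
  The monotone functions \<open>f x + L * x\<close> and \<open>L * x - f x\<close> induce Stieltjes measures
  whose sum is \<open>2 * L\<close> times Lebesgue measure.  Hence the first of them is absolutely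
  continuous, and its Radon-Nikodym density is, up to the constant \<open>L\<close>, a derivative of \<open>f\<close>
  in the integral sense.
\<close>

lemma Lipschitz_real_indefinite_integral:
  fixes f :: "real \<Rightarrow> real"
  assumes L: "0 < L" and f: "\<And>x y. \<bar>f x - f y\<bar> \<le> L * \<bar>x - y\<bar>"
  obtains g where "\<And>a b. a \<le> b \<Longrightarrow> (g has_integral (f b - f a)) {a..b}"
proof -
  define F where "F = (\<lambda>x. f x + L * x)"
  define G where "G = (\<lambda>x. L * x - f x)"
  have lip: "f y - f x \<le> L * (y - x)" "f x - f y \<le> L * (y - x)" if "x \<le> y" for x y
    using f[of x y] that by (auto simp: abs_le_iff algebra_simps)
  have F: "F x \<le> F y" and G: "G x \<le> G y" if "x \<le> y" for x y
    using lip[OF that] by (auto simp: F_def G_def algebra_simps)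
  have "L-lipschitz_on UNIV f"
    using f L by (auto simp: lipschitz_on_def dist_real_def)
  then have cf: "continuous_on UNIV f"
    by (rule lipschitz_on_continuous_on)
  then have cF: "continuous_on UNIV F" and cG: "continuous_on UNIV G"
    unfolding F_def G_def by (auto intro!: continuous_intros)
  let ?\<mu> = "interval_measure F" and ?\<nu> = "interval_measure G"
  have box: "emeasure (interval_measure H) {l<..<u} = ennreal (H u - H l)"
    if H: "\<And>x y. x \<le> y \<Longrightarrow> H x \<le> H y" "continuous_on UNIV H" and "l \<le> u" for H :: "real \<Rightarrow> real" and l u
  proof -
    have cH: "continuous_on {l..u} H" for l u
      using H(2) continuous_on_subset by blast
    have "{l<..<u} = {l<..u} - {u}"
      by auto
    moreover have "emeasure (interval_measure H) {u..u} = 0"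
      using emeasure_interval_measure_Icc[of u u H] H cH by auto
    then have "{u} \<in> null_sets (interval_measure H)"
      by (auto simp: null_sets_def)
    ultimately have "emeasure (interval_measure H) {l<..<u} = emeasure (interval_measure H) {l<..u}"
      by (simp add: emeasure_Diff_null_set)
    also have "\<dots> = ennreal (H u - H l)"
      using H \<open>l \<le> u\<close> by (intro emeasure_interval_measure_Ioc) (auto simp: continuous_on_eq_continuous_within intro: continuous_within_subset)
    finally show ?thesis .
  qed
  define M where "M = measure_of UNIV (sets borel) (\<lambda>A. ennreal (1 / (2 * L)) * (emeasure ?\<mu> A + emeasure ?\<nu> A))"
  have sM: "sets M = sets borel"
    unfolding M_def by (metis sets.sets_measure_of_eq space_borel)
  have eM: "emeasure M A = ennreal (1 / (2 * L)) * (emeasure ?\<mu> A + emeasure ?\<nu> A)" if "A \<in> sets borel" for A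
  proof (rule emeasure_measure_of[OF M_def])
    show "sets borel \<subseteq> Pow (UNIV :: real set)" by simp
    show "A \<in> sets M" using that sM by simp
    show "positive (sets M) (\<lambda>A. ennreal (1 / (2 * L)) * (emeasure ?\<mu> A + emeasure ?\<nu> A))"
      by (simp add: positive_def)
    show "countably_additive (sets M) (\<lambda>A. ennreal (1 / (2 * L)) * (emeasure ?\<mu> A + emeasure ?\<nu> A))"
      using sM by (auto simp: countably_additive_def suminf_add[symmetric] suminf_emeasure)
  qed
  have "lborel = M"
  proof (rule lborel_eqI)
    fix l u :: real assume "\<And>b. b \<in> Basis \<Longrightarrow> l \<bullet> b \<le> u \<bullet> b"
    then have lu: "l \<le> u" by simp
    have "emeasure M (box l u) = ennreal (1 / (2 * L)) * (ennreal (F u - F l) + ennreal (G u - G l))"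
      using lu F G cF cG by (simp add: eM box)
    also have "\<dots> = ennreal (1 / (2 * L) * (2 * L * (u - l)))"
      using F[OF lu] G[OF lu] L lu
      by (subst ennreal_plus[symmetric], simp, simp, subst ennreal_mult[symmetric])
        (auto simp: F_def G_def algebra_simps)
    finally show "emeasure M (box l u) = ennreal (\<Prod>b\<in>Basis. (u - l) \<bullet> b)"
      using L by simp
  qed (simp add: sM)
  then have ac: "absolutely_continuous lborel ?\<mu>"
    using eM L sM unfolding absolutely_continuous_def null_sets_def by auto
  have sf: "sigma_finite_measure ?\<mu>"
    using F cF by (intro sigma_finite_interval_measure) (auto simp: continuous_on_eq_continuous_within intro: continuous_within_subset)
  define r where "r = RN_deriv lborel ?\<mu>"
  have r: "r \<in> borel_measurable borel" "density lborel r = ?\<mu>" "AE x in lborel. r x \<noteq> \<infinity>"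
    unfolding r_def using sigma_finite_measure.density_RN_deriv[OF sigma_finite_lborel ac]
      sigma_finite_measure.RN_deriv_finite[OF sigma_finite_lborel sf ac] by auto
  have int: "((\<lambda>x. enn2real (r x)) has_integral F b - F a) {a..b}" if ab: "a \<le> b" for a b
  proof -
    have "((\<lambda>x. enn2real (r x) * indicator {a..b} x) has_integral F b - F a) UNIV"
    proof (rule nn_integral_has_integral)
      show "(\<lambda>x. enn2real (r x) * indicator {a..b} x) \<in> borel_measurable borel"
        using r(1) by measurable
      have "(\<integral>\<^sup>+x. ennreal (enn2real (r x) * indicator {a..b} x) \<partial>lborel) = (\<integral>\<^sup>+x. r x * indicator {a..b} x \<partial>lborel)"
        using r(3) by (intro nn_integral_cong_AE) (auto simp: indicator_def top.not_eq_extremum)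
      also have "\<dots> = emeasure ?\<mu> {a..b}"
        using r(1) by (subst r(2)[symmetric], subst emeasure_density) auto
      also have "\<dots> = ennreal (F b - F a)"
        using ab F cF by (intro emeasure_interval_measure_Icc) (auto intro: continuous_on_subset)
      finally show "(\<integral>\<^sup>+x. ennreal (enn2real (r x) * indicator {a..b} x) \<partial>lborel) = ennreal (F b - F a)" .
    qed (use r F[OF ab] in auto)
    then show ?thesis
      by (subst has_integral_restrict_UNIV[symmetric]) (simp add: indicator_def of_bool_def if_distrib cong: if_cong)
  qed
  have "((\<lambda>x. enn2real (r x) - L) has_integral f b - f a) {a..b}" if ab: "a \<le> b" for a b
    using has_integral_diff[OF int[OF ab] has_integral_const_real[of L a b]] ab
    by (simp add: F_def algebra_simps)
  with that show thesis by blast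
qed

text \<open>
  This is the Lebesgue differentiation theorem for one-sided intervals.  It bounds the difference
  quotients of \<open>f\<close> from the right only; the other side is obtained from it by reflection.
\<close>

lemma indefinite_integral_right_derivative:
  fixes f g :: "real \<Rightarrow> real"
  assumes g: "\<And>a b. a \<le> b \<Longrightarrow> (g has_integral (f b - f a)) {a..b}"
  obtains N where "negligible N"
    "\<And>x e. x \<notin> N \<Longrightarrow> 0 < e \<Longrightarrow> \<exists>d>0. \<forall>y. x < y \<and> y < x + d \<longrightarrow> \<bar>f y - f x - (y - x) * g x\<bar> \<le> e * \<bar>y - x\<bar>"
proof -
  have gi: "g integrable_on cbox a b" for a b
    using g[of a b] by (cases "a \<le> b") (auto simp: has_integral_integrable)
  obtain N where N: "negligible N" 
    "\<And>x e. x \<notin> N \<Longrightarrow> 0 < e \<Longrightarrow> \<exists>d>0. \<forall>h. 0 < h \<and> h < d \<longrightarrow>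
        norm (integral (cbox x (x + h *\<^sub>R One)) g /\<^sub>R h ^ DIM(real) - g x) < e"
    using integrable_ccontinuous_explicit[OF gi] by blast
  have "\<exists>d>0. \<forall>y. x < y \<and> y < x + d \<longrightarrow> \<bar>f y - f x - (y - x) * g x\<bar> \<le> e * \<bar>y - x\<bar>"
    if x: "x \<notin> N" "0 < e" for x e
  proof -
    obtain d where d: "d > 0" "\<And>h. 0 < h \<Longrightarrow> h < d \<Longrightarrow> 
        norm (integral (cbox x (x + h *\<^sub>R One)) g /\<^sub>R h ^ DIM(real) - g x) < e"
      using N(2)[OF x] by blast
    have "\<bar>f y - f x - (y - x) * g x\<bar> \<le> e * \<bar>y - x\<bar>" if y: "x < y" "y < x + d" for y
    proof -
      have "\<bar>(f y - f x) / (y - x) - g x\<bar> < e"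
        using d(2)[of "y - x"] y integral_unique[OF g, of x y] by (simp add: divide_inverse_commute)
      then have "(y - x) * \<bar>(f y - f x) / (y - x) - g x\<bar> \<le> (y - x) * e"
        using y by (intro mult_left_mono) auto
      moreover have "(y - x) * \<bar>(f y - f x) / (y - x) - g x\<bar> = \<bar>f y - f x - (y - x) * g x\<bar>"
      proof -
        have "f y - f x - (y - x) * g x = (y - x) * ((f y - f x) / (y - x) - g x)"
          using y by (subst right_diff_distrib) simp
        then show ?thesis
          using y by (simp only: abs_mult)
      qed
      ultimately show ?thesis using y by (simp add: mult.commute)
    qed
    with d(1) show ?thesis by blast
  qed
  with N(1) that show thesis by blast
qed

lemma Lipschitz_real_differentiable_negligible:
  fixes f :: "real \<Rightarrow> real"
  assumes f: "\<And>x y. \<bar>f x - f y\<bar> \<le> L * \<bar>x - y\<bar>"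
  obtains g N where "negligible N" "\<And>x. x \<notin> N \<Longrightarrow> (f has_real_derivative g x) (at x)"
proof -
  \<comment> \<open>The constant \<open>L\<close> need not be positive, but the representation lemma needs a positive one.\<close>
  have f': "\<bar>f x - f y\<bar> \<le> (\<bar>L\<bar> + 1) * \<bar>x - y\<bar>" for x y
    by (rule order_trans[OF f mult_right_mono]) auto
  obtain g where g: "\<And>a b. a \<le> b \<Longrightarrow> (g has_integral (f b - f a)) {a..b}"
    using Lipschitz_real_indefinite_integral[of "\<bar>L\<bar> + 1" f] f' by (auto simp: add_nonneg_pos)
  have g': "((\<lambda>x. g (- x)) has_integral (- f (- b) - - f (- a))) {a..b}" if "a \<le> b" for a b
    using g[of "-b" "-a"] that has_integral_reflect_real[where f = g and a = "-b" and b = "-a"] by auto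
  obtain N1 where N1: "negligible N1"
    "\<And>x e. x \<notin> N1 \<Longrightarrow> 0 < e \<Longrightarrow> \<exists>d>0. \<forall>y. x < y \<and> y < x + d \<longrightarrow> \<bar>f y - f x - (y - x) * g x\<bar> \<le> e * \<bar>y - x\<bar>"
    using indefinite_integral_right_derivative[of g f] g by blast
  obtain N2 where N2: "negligible N2"
    "\<And>x e. x \<notin> N2 \<Longrightarrow> 0 < e \<Longrightarrow> \<exists>d>0. \<forall>y. x < y \<and> y < x + d \<longrightarrow> 
       \<bar>- f (- y) - - f (- x) - (y - x) * g (- x)\<bar> \<le> e * \<bar>y - x\<bar>"
    using indefinite_integral_right_derivative[of "\<lambda>x. g (- x)" "\<lambda>x. - f (- x)"] g' by blast
  have "(f has_real_derivative g x) (at x)" if x: "x \<notin> N1 \<union> uminus ` N2" for x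
    unfolding has_field_derivative_def has_derivative_at_alt
  proof (intro conjI allI impI)
    fix e :: real assume e: "0 < e"
    have "- x \<notin> N2" using x by (metis UnCI add.inverse_inverse imageI)
    then obtain d2 where d2: "d2 > 0" "\<And>y. - x < y \<Longrightarrow> y < - x + d2 \<Longrightarrow> 
       \<bar>- f (- y) - - f (- (- x)) - (y - - x) * g (- (- x))\<bar> \<le> e * \<bar>y - (- x)\<bar>"
      using N2(2)[OF _ e] by blast
    obtain d1 where d1: "d1 > 0" "\<And>y. x < y \<Longrightarrow> y < x + d1 \<Longrightarrow> \<bar>f y - f x - (y - x) * g x\<bar> \<le> e * \<bar>y - x\<bar>"
      using N1(2)[OF _ e] x by blast
    have "\<bar>f y - f x - g x * (y - x)\<bar> \<le> e * \<bar>y - x\<bar>" if y: "\<bar>y - x\<bar> < min d1 d2" for y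
    proof -
      consider "y = x" | "x < y" | "y < x" by linarith
      then show ?thesis
      proof cases
        case 3
        then have "\<bar>- f y + f x - (x - y) * g x\<bar> \<le> e * \<bar>x - y\<bar>"
          using d2(2)[of "- y"] y by (simp add: add.commute)
        moreover have "- f y + f x - (x - y) * g x = - (f y - f x - g x * (y - x))"
          by (simp add: algebra_simps)
        ultimately show ?thesis by (simp add: abs_minus_commute)
      qed (use d1(2)[of y] y in \<open>auto simp: mult.commute\<close>)
    qed
    then show "\<exists>d>0. \<forall>y. norm (y - x) < d \<longrightarrow> norm (f y - f x - g x * (y - x)) \<le> e * norm (y - x)"
      using d1(1) d2(1) by (intro exI[of _ "min d1 d2"]) auto
  qed (rule bounded_linear_mult_right)
  moreover have "negligible (N1 \<union> uminus ` N2)"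
    using N1(1) N2(1) by (intro negligible_Un negligible_differentiable_image_negligible)
      (auto intro!: differentiable_on_minus differentiable_on_id)
  ultimately show thesis using that by blast
qed

text \<open>
  Rademacher's theorem in one variable.  The derivative is two-sided, so the statement is confined
  to the open interval.
\<close>

lemma Lipschitz_on_AE_vector_derivative:
  fixes f :: "real \<Rightarrow> 'a::euclidean_space"
  assumes f: "C-lipschitz_on {a..b} f"
  shows "AE x in lebesgue. a < x \<and> x < b \<longrightarrow> (f has_vector_derivative vector_derivative f (at x)) (at x)"
proof (cases "a \<le> b")
  case True
  \<comment> \<open>Extend \<open>f\<close> by constants to a Lipschitz function on the whole line.\<close>
  define h where "h = (\<lambda>x. f (max a (min b x)))"
  have h: "norm (h x - h y) \<le> C * \<bar>x - y\<bar>" for x y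
  proof -
    have "norm (h x - h y) \<le> C * \<bar>max a (min b x) - max a (min b y)\<bar>"
      using lipschitz_onD[OF f, of "max a (min b x)" "max a (min b y)"] True
      by (auto simp: h_def dist_norm dist_real_def)
    also have "\<dots> \<le> C * \<bar>x - y\<bar>"
      using lipschitz_on_nonneg[OF f] by (intro mult_left_mono) auto
    finally show ?thesis .
  qed
  have "\<exists>g N. negligible N \<and> (\<forall>x. x \<notin> N \<longrightarrow> ((\<lambda>x. h x \<bullet> i) has_real_derivative g x) (at x))" if "i \<in> Basis" for i
  proof -
    have "\<bar>h x \<bullet> i - h y \<bullet> i\<bar> \<le> C * \<bar>x - y\<bar>" for x y
      using order_trans[OF Basis_le_norm[OF that] h[of x y]] by (simp add: inner_diff_left)
    from Lipschitz_real_differentiable_negligible[OF this] show ?thesis by metis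
  qed
  then obtain g N where gN: "\<And>i. i \<in> Basis \<Longrightarrow> negligible (N i)"
    "\<And>i x. i \<in> Basis \<Longrightarrow> x \<notin> N i \<Longrightarrow> ((\<lambda>x. h x \<bullet> i) has_real_derivative g i x) (at x)"
    by metis
  have "negligible (\<Union>i\<in>Basis. N i)"
    using gN(1) by (intro negligible_Union) auto
  then have AE: "AE x in lebesgue. x \<notin> (\<Union>i\<in>Basis. N i)"
    using AE_not_in negligible_iff_null_sets by blast
  have "(f has_vector_derivative vector_derivative f (at x)) (at x)"
    if x: "a < x" "x < b" "x \<notin> (\<Union>i\<in>Basis. N i)" for x
  proof -
    have "((\<lambda>x. h x \<bullet> i) has_derivative (\<lambda>t. (t *\<^sub>R (\<Sum>i\<in>Basis. g i x *\<^sub>R i)) \<bullet> i)) (at x)" if i: "i \<in> Basis" for i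
      using gN(2)[OF i] x(3) i
      by (simp add: has_field_derivative_def mult_commute_abs)
    then have "(h has_vector_derivative (\<Sum>i\<in>Basis. g i x *\<^sub>R i)) (at x)"
      unfolding has_vector_derivative_def by (subst has_derivative_componentwise_within) auto
    then have "(f has_vector_derivative (\<Sum>i\<in>Basis. g i x *\<^sub>R i)) (at x)"
      by (rule has_vector_derivative_transform_within_open[where S = "{a<..<b}"]) (use x in \<open>auto simp: h_def\<close>)
    then show ?thesis
      using vector_derivative_works differentiableI_vector by blast
  qed
  then show ?thesis
    using AE by (auto elim!: eventually_mono)
qed auto

section \<open>Lower bounds for the action by Riemann sums\<close>

text \<open>
  Jensen's inequality for a convex, positively homogeneous integrand takes this discrete form.
\<close>

lemma geometric_integrand_subadditive:
  assumes l: "geometric_integrand D l" and x: "x \<in> D"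
  shows "l x (\<Sum>i\<in>I. v i) \<le> (\<Sum>i\<in>I. l x (v i))"
proof -
  have hom: "l x (c *\<^sub>R y) = c * l x y" if "0 \<le> c" for c y
    using l x that by (auto simp: geometric_integrand_def)
  have add: "l x (u + w) \<le> l x u + l x w" for u w
  proof -
    have "convex_on UNIV (l x)"
      using l x by (simp add: geometric_integrand_def)
    from convex_onD[OF this, of "1/2" "2 *\<^sub>R u" "2 *\<^sub>R w"] show ?thesis
      using hom[of 2 u] hom[of 2 w] by simp
  qed
  show ?thesis
  proof (induction I rule: infinite_finite_induct)
    case (insert i I)
    then show ?case
      using add[of "v i" "\<Sum>i\<in>I. v i"] by simp
  qed (use hom[of 0 0] in auto)
qed

lemma geometric_integrand_tendsto:
  assumes l: "geometric_integrand D l" and D: "\<And>k. x k \<in> D" "x' \<in> D"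
    and xy: "x \<longlonglongrightarrow> x'" "y \<longlonglongrightarrow> y'"
  shows "(\<lambda>k. l (x k) (y k)) \<longlonglongrightarrow> l x' y'"
proof -
  have "continuous_on (D \<times> UNIV) (\<lambda>(x, y). l x y)"
    using l by (simp add: geometric_integrand_def)
  then have "(\<lambda>k. (\<lambda>(x, y). l x y) (x k, y k)) \<longlonglongrightarrow> (\<lambda>(x, y). l x y) (x', y')"
    by (rule continuous_on_tendsto_compose) (use D xy in \<open>auto intro!: tendsto_Pair\<close>)
  then show ?thesis by simp
qed

lemma geometric_integrand_normalize:
  assumes l: "geometric_integrand D l" and x: "x \<in> D"
  shows "l x y = norm y * l x (sgn y)"
proof -
  have "l x (norm y *\<^sub>R sgn y) = norm y * l x (sgn y)"
    using l x by (simp add: geometric_integrand_def)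
  moreover have "norm y *\<^sub>R sgn y = y"
    by (cases "y = 0") (simp_all add: sgn_div_norm)
  ultimately show ?thesis
    by simp
qed

lemma geometric_integrand_bounded:
  assumes l: "geometric_integrand D l" and K: "compact K" "K \<subseteq> D"
  obtains M where "0 \<le> M" "\<And>x y. x \<in> K \<Longrightarrow> l x y \<le> M * norm y"
proof -
  have "continuous_on (K \<times> cball 0 1) (\<lambda>(x, y). l x y)"
    using l K by (auto simp: geometric_integrand_def intro: continuous_on_subset)
  then have "compact ((\<lambda>(x, y). l x y) ` (K \<times> cball 0 1))"
    using K by (intro compact_continuous_image compact_Times) auto
  then obtain M where M: "M > 0" "\<And>z. z \<in> (\<lambda>(x, y). l x y) ` (K \<times> cball 0 1) \<Longrightarrow> norm z \<le> M"
    using compact_imp_bounded bounded_pos by metis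
  have "l x y \<le> M * norm y" if "x \<in> K" for x y
  proof -
    have "\<bar>l x (sgn y)\<bar> \<le> M"
      using M(2)[OF imageI, of "(x, sgn y)"] that by (auto simp: norm_sgn)
    then have "norm y * l x (sgn y) \<le> norm y * M"
      by (intro mult_left_mono) auto
    then show ?thesis
      using geometric_integrand_normalize[OF l, of x y] that K by (auto simp: mult.commute)
  qed
  with M(1) that show thesis by (meson less_imp_le)
qed

lemma geometric_integrand_uniformly_continuous:
  assumes l: "geometric_integrand D l" and K: "compact K" "K \<subseteq> D" and e: "0 < e"
  obtains d where "0 < d"
    "\<And>x x' y. x \<in> K \<Longrightarrow> x' \<in> K \<Longrightarrow> dist x x' < d \<Longrightarrow> l x y \<le> l x' y + e * norm y"
proof -
  have "continuous_on (K \<times> cball 0 1) (\<lambda>(x, y). l x y)"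
    using l K by (auto simp: geometric_integrand_def intro: continuous_on_subset)
  then have "uniformly_continuous_on (K \<times> cball 0 1) (\<lambda>(x, y). l x y)"
    using K by (intro compact_uniformly_continuous compact_Times) auto
  then obtain d where d: "d > 0" "\<And>p q. p \<in> K \<times> cball 0 1 \<Longrightarrow> q \<in> K \<times> cball 0 1 \<Longrightarrow> dist q p < d \<Longrightarrow>
      dist ((\<lambda>(x, y). l x y) q) ((\<lambda>(x, y). l x y) p) < e"
    using e unfolding uniformly_continuous_on_def by metis
  have "l x y \<le> l x' y + e * norm y" if x: "x \<in> K" "x' \<in> K" "dist x x' < d" for x x' y
  proof -
    have "\<bar>l x (sgn y) - l x' (sgn y)\<bar> < e"
      using d(2)[of "(x', sgn y)" "(x, sgn y)"] x
      by (auto simp: norm_sgn dist_Pair_Pair dist_real_def)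
    then have "norm y * l x (sgn y) \<le> norm y * (l x' (sgn y) + e)"
      by (intro mult_left_mono) auto
    then show ?thesis
      using geometric_integrand_normalize[OF l, of x y] geometric_integrand_normalize[OF l, of x' y] x K
      by (auto simp: algebra_simps subset_iff)
  qed
  with d(1) that show thesis by blast
qed

text \<open>
  Neither end point of the shrinking intervals has to coincide with \<open>t\<close>.
\<close>

lemma has_vector_derivative_straddle_tendsto:
  fixes f :: "real \<Rightarrow> 'a::real_normed_vector"
  assumes f: "(f has_vector_derivative v) (at t)"
    and ab: "\<And>k::nat. a k \<le> t" "\<And>k. t \<le> b k" "\<And>k. a k < b k" "a \<longlonglongrightarrow> t" "b \<longlonglongrightarrow> t"
  shows "(\<lambda>k. (f (b k) - f (a k)) /\<^sub>R (b k - a k)) \<longlonglongrightarrow> v"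
proof (rule LIMSEQ_I)
  fix e :: real assume e: "0 < e"
  then have "0 < e / 2" by simp
  with f obtain d where d: "d > 0"
    "\<And>y. norm (y - t) < d \<Longrightarrow> norm (f y - f t - (y - t) *\<^sub>R v) \<le> e / 2 * norm (y - t)"
    unfolding has_vector_derivative_def has_derivative_at_alt by blast
  have "\<forall>\<^sub>F k in sequentially. dist (a k) t < d \<and> dist (b k) t < d"
    using ab(4,5) d(1) by (intro eventually_conj tendstoD)
  then have "\<forall>\<^sub>F k in sequentially. norm ((f (b k) - f (a k)) /\<^sub>R (b k - a k) - v) < e"
  proof eventually_elim
    case (elim k)
    define h where "h = b k - a k"
    have h: "h > 0" using ab(3)[of k] by (simp add: h_def)
    have "(f (b k) - f (a k)) /\<^sub>R h - v = (f (b k) - f (a k) - h *\<^sub>R v) /\<^sub>R h"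
      using h by (simp add: scaleR_diff_right)
    also have "f (b k) - f (a k) - h *\<^sub>R v
      = (f (b k) - f t - (b k - t) *\<^sub>R v) - (f (a k) - f t - (a k - t) *\<^sub>R v)"
      by (simp add: h_def algebra_simps)
    finally have "norm ((f (b k) - f (a k)) /\<^sub>R h - v)
      = norm ((f (b k) - f t - (b k - t) *\<^sub>R v) - (f (a k) - f t - (a k - t) *\<^sub>R v)) / h"
      using h by (simp add: divide_inverse_commute)
    also have "\<dots> \<le> (e / 2 * norm (b k - t) + e / 2 * norm (a k - t)) / h"
      using h elim
      by (intro divide_right_mono order_trans[OF norm_triangle_ineq4] add_mono d(2)) (simp_all add: dist_norm)
    also have "\<dots> = e / 2"
      using h ab(1,2)[of k] by (simp add: h_def field_simps)
    finally show ?case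
      using e by (simp add: h_def)
  qed
  then show "\<exists>N. \<forall>k\<ge>N. norm ((f (b k) - f (a k)) /\<^sub>R (b k - a k) - v) < e"
    by (simp add: eventually_sequentially)
qed

text \<open>
  The Riemann sum of the action of \<open>\<psi>\<close> for the division of \<open>[0, 1]\<close> into \<open>m\<close> intervals of
  equal length.  By homogeneity the increment of \<open>\<psi>\<close> replaces derivative times step width.
  For \<open>m = 0\<close> the sum is empty.
\<close>

definition polygonal_action ::
    "(real ^ 'n::finite \<Rightarrow> real ^ 'n \<Rightarrow> real) \<Rightarrow> nat \<Rightarrow> (real \<Rightarrow> real ^ 'n) \<Rightarrow> real" where
  "polygonal_action l m \<psi> =
     (\<Sum>i<m. l (\<psi> (real i / real m)) (\<psi> (real (Suc i) / real m) - \<psi> (real i / real m)))"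

text \<open>
  The polygonal action is the integral of a step function that evaluates \<open>l\<close> at the difference
  quotients of \<open>\<psi>\<close> on the cells of the division.  Almost everywhere these quotients converge to
  the derivative, and the Lipschitz constant provides the integrable bound.
\<close>

lemma polygonal_action_tendsto_integral:
  fixes \<psi> :: "real \<Rightarrow> real ^ 'n::finite"
  assumes l: "geometric_integrand D l" and K: "compact K" "K \<subseteq> D"
    and \<psi>: "C-lipschitz_on {0..1} \<psi>" "\<psi> ` {0..1} \<subseteq> K"
  shows "(\<lambda>m. ennreal (polygonal_action l (Suc m) \<psi>)) \<longlonglongrightarrow>
    (\<integral>\<^sup>+\<alpha>\<in>{0..1}. ennreal (l (\<psi> \<alpha>) (vector_derivative \<psi> (at \<alpha>))) \<partial>lebesgue)"
proof -
  obtain M where M: "0 \<le> M" "\<And>x y. x \<in> K \<Longrightarrow> l x y \<le> M * norm y"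
    using geometric_integrand_bounded[OF l K] by blast
  have C0: "0 \<le> C" using lipschitz_on_nonneg[OF \<psi>(1)] .
  have l0: "0 \<le> l x y" if "x \<in> K" for x y
    using l that K by (auto simp: geometric_integrand_def)
  define t where "t = (\<lambda>m i. real i / real (Suc m))"
  have t01: "t m i \<in> {0..1}" if "i \<le> Suc m" for m i
    using that by (auto simp: t_def field_simps)
  have \<psi>K: "\<psi> (t m i) \<in> K" if "i \<le> Suc m" for m i
    using t01[OF that] \<psi>(2) by blast
  define c where "c = (\<lambda>m i. l (\<psi> (t m i)) ((\<psi> (t m (Suc i)) - \<psi> (t m i)) /\<^sub>R (t m (Suc i) - t m i)))"
  have dt: "t m (Suc i) - t m i = 1 / real (Suc m)" for m i
    by (simp add: t_def diff_divide_distrib[symmetric])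
  have c: "0 \<le> c m i" "c m i \<le> M * C" if "i \<le> m" for m i
  proof -
    show "0 \<le> c m i" using \<psi>K[of i m] l0 that by (simp add: c_def)
    have "norm (\<psi> (t m (Suc i)) - \<psi> (t m i)) \<le> C * \<bar>t m (Suc i) - t m i\<bar>"
      using lipschitz_onD[OF \<psi>(1) t01 t01, of "Suc i" m i m] that by (simp add: dist_norm)
    then have "norm ((\<psi> (t m (Suc i)) - \<psi> (t m i)) /\<^sub>R (t m (Suc i) - t m i)) \<le> C"
      unfolding dt by (simp add: pos_le_divide_eq mult.commute del: of_nat_Suc)
    then show "c m i \<le> M * C"
      unfolding c_def using M(2)[OF \<psi>K, of i m] that M(1)
      by (meson le_Suc_eq mult_left_mono order_trans)
  qed
  \<comment> \<open>The step function whose integral is the polygonal action.\<close>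
  define g where "g = (\<lambda>m \<alpha>. \<Sum>i<Suc m. ennreal (c m i) * indicator {t m i..<t m (Suc i)} \<alpha>)"
  have g_eq: "g m \<alpha> = ennreal (c m (nat \<lfloor>real (Suc m) * \<alpha>\<rfloor>))" "nat \<lfloor>real (Suc m) * \<alpha>\<rfloor> \<le> m"
     "t m (nat \<lfloor>real (Suc m) * \<alpha>\<rfloor>) \<le> \<alpha>" "\<alpha> \<le> t m (Suc (nat \<lfloor>real (Suc m) * \<alpha>\<rfloor>))"
    if \<alpha>: "\<alpha> \<in> {0..<1}" for m \<alpha>
  proof -
    define j where "j = nat \<lfloor>real (Suc m) * \<alpha>\<rfloor>"
    have "0 \<le> real (Suc m) * \<alpha>" "real (Suc m) * \<alpha> < real (Suc m)"
      using \<alpha> by auto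
    then have j: "real j \<le> real (Suc m) * \<alpha>" "real (Suc m) * \<alpha> < real j + 1" "j < Suc m"
      unfolding j_def by linarith+
    have ind: "\<alpha> \<in> {t m i..<t m (Suc i)} \<longleftrightarrow> i = j" for i
    proof -
      have "\<alpha> \<in> {t m i..<t m (Suc i)} \<longleftrightarrow> real i \<le> real (Suc m) * \<alpha> \<and> real (Suc m) * \<alpha> < real i + 1"
        by (auto simp: t_def field_simps)
      also have "\<dots> \<longleftrightarrow> i = j"
        using j by linarith
      finally show ?thesis .
    qed
    have "g m \<alpha> = (\<Sum>i<Suc m. if i = j then ennreal (c m i) else 0)"
      unfolding g_def by (intro sum.cong refl) (simp add: indicator_def ind del: atLeastLessThan_iff)
    also have "\<dots> = ennreal (c m j)"
      using j(3) by simp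
    finally show "g m \<alpha> = ennreal (c m (nat \<lfloor>real (Suc m) * \<alpha>\<rfloor>))"
      by (simp add: j_def)
    show "nat \<lfloor>real (Suc m) * \<alpha>\<rfloor> \<le> m" using j(3) by (simp add: j_def)
    show "t m (nat \<lfloor>real (Suc m) * \<alpha>\<rfloor>) \<le> \<alpha>" "\<alpha> \<le> t m (Suc (nat \<lfloor>real (Suc m) * \<alpha>\<rfloor>))"
      using ind[of j] unfolding j_def by auto
  qed
  have step_meas: "(\<lambda>\<alpha>. ennreal (c m i) * indicator {t m i..<t m (Suc i)} \<alpha>) \<in> borel_measurable lebesgue" for m i
    by (intro measurable_completion) measurable
  have g_meas: "g m \<in> borel_measurable lebesgue" for m
    unfolding g_def by (intro borel_measurable_sum step_meas)
  have g_int: "(\<integral>\<^sup>+\<alpha>. g m \<alpha> \<partial>lebesgue) = ennreal (polygonal_action l (Suc m) \<psi>)" for m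
  proof -
    have em: "emeasure lebesgue {t m i..<t m (Suc i)} = ennreal (1 / real (Suc m))" for i
      using dt[of m i] by (simp add: t_def divide_right_mono)
    have "(\<integral>\<^sup>+\<alpha>. g m \<alpha> \<partial>lebesgue) = (\<Sum>i<Suc m. ennreal (c m i) * emeasure lebesgue {t m i..<t m (Suc i)})"
      unfolding g_def by (subst nn_integral_sum[OF step_meas], subst nn_integral_cmult_indicator) auto
    also have "\<dots> = (\<Sum>i<Suc m. ennreal (c m i * (1 / real (Suc m))))"
      unfolding em by (intro sum.cong refl ennreal_mult[symmetric]) (auto intro: c)
    also have "\<dots> = ennreal (\<Sum>i<Suc m. c m i * (1 / real (Suc m)))"
      using c(1)[of _ m] by (intro sum_ennreal) auto
    also have "(\<Sum>i<Suc m. c m i * (1 / real (Suc m))) = polygonal_action l (Suc m) \<psi>"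
      unfolding polygonal_action_def
    proof (intro sum.cong refl)
      fix i assume "i \<in> {..<Suc m}"
      then have "\<psi> (t m i) \<in> D" using \<psi>K[of i m] K by auto
      then have "c m i = real (Suc m) * l (\<psi> (t m i)) (\<psi> (t m (Suc i)) - \<psi> (t m i))"
        using l unfolding c_def dt geometric_integrand_def by simp
      then show "c m i * (1 / real (Suc m)) = l (\<psi> (real i / real (Suc m))) (\<psi> (real (Suc i) / real (Suc m)) - \<psi> (real i / real (Suc m)))"
        by (simp add: t_def)
    qed
    finally show ?thesis .
  qed
  have g_bound: "AE \<alpha> in lebesgue. g m \<alpha> \<le> ennreal (M * C) * indicator {0..1} \<alpha>" for m
  proof -
    have "g m \<alpha> \<le> ennreal (M * C) * indicator {0..1} \<alpha>" for \<alpha>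
    proof (cases "\<alpha> \<in> {0..<1}")
      case True
      then show ?thesis
        using g_eq(1,2)[OF True, of m] c(2)[of "nat \<lfloor>real (Suc m) * \<alpha>\<rfloor>" m]
        by (auto simp: indicator_def intro: ennreal_leI)
    next
      case False
      have "\<alpha> \<notin> {t m i..<t m (Suc i)}" if "i < Suc m" for i
        using False t01[of i m] t01[of "Suc i" m] that by auto
      then have "g m \<alpha> = 0"
        unfolding g_def by (intro sum.neutral) (auto simp: indicator_def)
      then show ?thesis by simp
    qed
    then show ?thesis by simp
  qed
  have g_lim: "AE \<alpha> in lebesgue. (\<lambda>m. g m \<alpha>) \<longlonglongrightarrow>
      ennreal (l (\<psi> \<alpha>) (vector_derivative \<psi> (at \<alpha>))) * indicator {0..1} \<alpha>"
  proof -
    have conv: "(\<lambda>m. g m \<alpha>) \<longlonglongrightarrow> ennreal (l (\<psi> \<alpha>) (vector_derivative \<psi> (at \<alpha>))) * indicator {0..1} \<alpha>"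
      if d: "0 < \<alpha> \<and> \<alpha> < 1 \<longrightarrow> (\<psi> has_vector_derivative vector_derivative \<psi> (at \<alpha>)) (at \<alpha>)"
        and "\<alpha> \<noteq> 0" "\<alpha> \<noteq> 1" for \<alpha>
    proof (cases "0 < \<alpha> \<and> \<alpha> < 1")
      case True
      then have \<alpha>: "\<alpha> \<in> {0..<1}" by simp
      define a where "a = (\<lambda>m. t m (nat \<lfloor>real (Suc m) * \<alpha>\<rfloor>))"
      define b where "b = (\<lambda>m. t m (Suc (nat \<lfloor>real (Suc m) * \<alpha>\<rfloor>)))"
      have ba: "b m - a m = 1 / real (Suc m)" for m
        by (simp only: a_def b_def dt)
      have ab: "a m \<le> \<alpha>" "\<alpha> \<le> b m" "\<alpha> - 1 / real (Suc m) \<le> a m" "b m \<le> \<alpha> + 1 / real (Suc m)" for m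
      proof -
        show "a m \<le> \<alpha>" "\<alpha> \<le> b m"
          unfolding a_def b_def using g_eq(3,4)[OF \<alpha>, of m] by auto
        then show "\<alpha> - 1 / real (Suc m) \<le> a m" "b m \<le> \<alpha> + 1 / real (Suc m)"
          using ba[of m] by linarith+
      qed
      have lim1: "(\<lambda>m. 1 / real (Suc m)) \<longlonglongrightarrow> 0"
        using LIMSEQ_inverse_real_of_nat by (simp add: inverse_eq_divide)
      have "(\<lambda>m. \<alpha> - 1 / real (Suc m)) \<longlonglongrightarrow> \<alpha> - 0" "(\<lambda>m. \<alpha> + 1 / real (Suc m)) \<longlonglongrightarrow> \<alpha> + 0"
        by (intro tendsto_intros lim1)+
      then have shrink: "(\<lambda>m. \<alpha> - 1 / real (Suc m)) \<longlonglongrightarrow> \<alpha>" "(\<lambda>m. \<alpha> + 1 / real (Suc m)) \<longlonglongrightarrow> \<alpha>"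
        by (simp_all only: diff_zero add_0_right)
      have lim: "a \<longlonglongrightarrow> \<alpha>" "b \<longlonglongrightarrow> \<alpha>"
        by (rule tendsto_sandwich[OF _ _ shrink(1) tendsto_const], use ab in auto)
          (rule tendsto_sandwich[OF _ _ tendsto_const shrink(2)], use ab in auto)
      have aK: "a m \<in> {0..1}" "\<psi> (a m) \<in> D" for m
        unfolding a_def using g_eq(2)[OF \<alpha>, of m] t01[of "nat \<lfloor>real (Suc m) * \<alpha>\<rfloor>" m] \<psi>K[of "nat \<lfloor>real (Suc m) * \<alpha>\<rfloor>" m] K by auto
      have "continuous_on {0..1} \<psi>" using \<psi>(1) by (rule lipschitz_on_continuous_on)
      then have "(\<lambda>m. \<psi> (a m)) \<longlonglongrightarrow> \<psi> \<alpha>"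
        by (rule continuous_on_tendsto_compose) (use lim aK \<alpha> in auto)
      moreover have "(\<lambda>m. (\<psi> (b m) - \<psi> (a m)) /\<^sub>R (b m - a m)) \<longlonglongrightarrow> vector_derivative \<psi> (at \<alpha>)"
        using d True ab lim by (intro has_vector_derivative_straddle_tendsto)
          (auto simp: less_iff_diff_less_0[of "a _"] ba[THEN arg_cong[of _ _ uminus], simplified])
      moreover have "\<psi> \<alpha> \<in> D" using \<psi>(2) K \<alpha> by force
      ultimately have "(\<lambda>m. l (\<psi> (a m)) ((\<psi> (b m) - \<psi> (a m)) /\<^sub>R (b m - a m))) \<longlonglongrightarrow> l (\<psi> \<alpha>) (vector_derivative \<psi> (at \<alpha>))"
        using aK by (intro geometric_integrand_tendsto[OF l]) auto
      then show ?thesis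
        using g_eq(1)[OF \<alpha>] \<alpha> by (auto simp: c_def a_def b_def)
    next
      case False
      then have "\<alpha> \<notin> {0..1}" using that by auto
      moreover have "\<alpha> \<notin> {t m i..<t m (Suc i)}" if "i < Suc m" for i m
        using \<open>\<alpha> \<notin> {0..1}\<close> t01[of i m] t01[of "Suc i" m] that by auto
      then have "g m \<alpha> = 0" for m
        unfolding g_def by (intro sum.neutral) (auto simp: indicator_def)
      ultimately show ?thesis by simp
    qed
    have "AE \<alpha> in lebesgue. \<alpha> \<notin> {0, 1::real}"
      by (intro AE_not_in) (auto simp: negligible_iff_null_sets[symmetric])
    with Lipschitz_on_AE_vector_derivative[OF \<psi>(1)] show ?thesis
      by eventually_elim (use conv in auto)
  qed
  have "(\<lambda>m. \<integral>\<^sup>+\<alpha>. g m \<alpha> \<partial>lebesgue) \<longlonglongrightarrow> (\<integral>\<^sup>+\<alpha>. liminf (\<lambda>m. g m \<alpha>) \<partial>lebesgue)"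
  proof (rule nn_integral_dominated_convergence)
    show "AE \<alpha> in lebesgue. g m \<alpha> \<le> ennreal (M * C) * indicator {0..1} \<alpha>" for m by (rule g_bound)
    show "(\<integral>\<^sup>+\<alpha>. ennreal (M * C) * indicator {0..1::real} \<alpha> \<partial>lebesgue) < \<infinity>"
      by (subst nn_integral_cmult_indicator) (auto simp: ennreal_mult_less_top)
    show "AE \<alpha> in lebesgue. (\<lambda>m. g m \<alpha>) \<longlonglongrightarrow> liminf (\<lambda>m. g m \<alpha>)"
      using g_lim by eventually_elim (simp add: lim_imp_Liminf)
    show "(\<lambda>\<alpha>. ennreal (M * C) * indicator {0..1::real} \<alpha>) \<in> borel_measurable lebesgue"
      by (intro measurable_completion) measurable
    show "(\<lambda>\<alpha>. liminf (\<lambda>m. g m \<alpha>)) \<in> borel_measurable lebesgue"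
      by (intro borel_measurable_liminf g_meas)
  qed (rule g_meas)
  also have "(\<integral>\<^sup>+\<alpha>. liminf (\<lambda>m. g m \<alpha>) \<partial>lebesgue)
    = (\<integral>\<^sup>+\<alpha>\<in>{0..1}. ennreal (l (\<psi> \<alpha>) (vector_derivative \<psi> (at \<alpha>))) \<partial>lebesgue)"
    using g_lim by (intro nn_integral_cong_AE) (auto elim!: eventually_mono simp: lim_imp_Liminf)
  finally show ?thesis
    by (simp add: g_int)
qed

text \<open>
  Up to an error that is uniform over all \<open>C\<close>-Lipschitz curves in \<open>K\<close>, refining a fine enough
  division does not decrease the polygonal action: on a short interval the first argument of \<open>l\<close>
  can be frozen by uniform continuity, and then subadditivity applies.
\<close>

lemma polygonal_action_refine:
  fixes l :: "real ^ 'n::finite \<Rightarrow> real ^ 'n \<Rightarrow> real"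
  assumes l: "geometric_integrand D l" and K: "compact K" "K \<subseteq> D" and e: "0 < e" and C: "0 \<le> C"
  obtains m0 where "0 < m0" "\<And>m j \<psi>. m0 \<le> m \<Longrightarrow> 0 < j \<Longrightarrow> C-lipschitz_on {0..1} \<psi> \<Longrightarrow> \<psi> ` {0..1} \<subseteq> K \<Longrightarrow>
     polygonal_action l m \<psi> \<le> polygonal_action l (m * j) \<psi> + e"
proof -
  \<comment> \<open>The errors add up to at most \<open>e'\<close> times the length of the curve, which is at most \<open>C\<close>.\<close>
  define e' where "e' = e / (C + 1)"
  have e': "0 < e'" "e' * C \<le> e" using e C by (auto simp: e'_def field_simps)
  obtain d where d: "0 < d"
    "\<And>x x' y. x \<in> K \<Longrightarrow> x' \<in> K \<Longrightarrow> dist x x' < d \<Longrightarrow> l x y \<le> l x' y + e' * norm y"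
    using geometric_integrand_uniformly_continuous[OF l K e'(1)] by blast
  obtain k :: nat where "C / d < k"
    using reals_Archimedean2 by blast
  then obtain m0 :: nat where m0: "0 < m0" "C / d < m0"
    using that[of "Suc k"] by simp
  have "polygonal_action l m \<psi> \<le> polygonal_action l (m * j) \<psi> + e"
    if mj: "m0 \<le> m" "0 < j" and \<psi>: "C-lipschitz_on {0..1} \<psi>" "\<psi> ` {0..1} \<subseteq> K" for m j \<psi>
  proof -
    define t where "t = (\<lambda>k. real k / real (m * j))"
    have m: "0 < m" using mj m0 by linarith
    have "C / d < m" using m0(2) mj(1) by linarith
    then have Cm: "C / m < d"
      using m d(1) by (simp add: field_simps)
    have t_m: "real i / real m = t (i * j)" for i
      using mj by (simp add: t_def)
    have t01: "t k \<in> {0..1}" if "k \<le> m * j" for k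
      using that m mj(2) by (auto simp: t_def divide_le_eq_1 simp flip: of_nat_mult)
    have \<psi>K: "\<psi> (t k) \<in> K" if "k \<le> m * j" for k
      using t01[OF that] \<psi>(2) by blast
    have lip: "norm (\<psi> (t k') - \<psi> (t k)) \<le> C * (t k' - t k)" if "k \<le> k'" "k' \<le> m * j" for k k'
    proof -
      have "t k \<le> t k'" using that by (simp add: t_def divide_right_mono)
      then show ?thesis
        using lipschitz_onD[OF \<psi>(1) t01 t01, of k' k] that by (simp add: dist_norm)
    qed
    have "l (\<psi> (t (i * j))) (\<psi> (t (Suc i * j)) - \<psi> (t (i * j)))
       \<le> (\<Sum>k\<in>{i * j..<i * j + j}. l (\<psi> (t k)) (\<psi> (t (Suc k)) - \<psi> (t k))) + e / m" if i: "i < m" for i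
    proof -
      have ij: "i * j + j \<le> m * j"
        using i by (metis Suc_leI add.commute mult_Suc mult_le_mono1)
      have inc: "\<psi> (t (Suc i * j)) - \<psi> (t (i * j)) = (\<Sum>k\<in>{i * j..<i * j + j}. \<psi> (t (Suc k)) - \<psi> (t k))"
        by (subst sum_Suc_diff') (auto simp: add.commute)
      have "\<psi> (t (i * j)) \<in> D" using \<psi>K[of "i * j"] i K by auto
      then have "l (\<psi> (t (i * j))) (\<psi> (t (Suc i * j)) - \<psi> (t (i * j)))
        \<le> (\<Sum>k\<in>{i * j..<i * j + j}. l (\<psi> (t (i * j))) (\<psi> (t (Suc k)) - \<psi> (t k)))"
        unfolding inc by (rule geometric_integrand_subadditive[OF l])
      also have "\<dots> \<le> (\<Sum>k\<in>{i * j..<i * j + j}. l (\<psi> (t k)) (\<psi> (t (Suc k)) - \<psi> (t k)) + e' * (C * (1 / (m * j))))"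
      proof (intro sum_mono)
        fix k assume k: "k \<in> {i * j..<i * j + j}"
        have "t k - t (i * j) \<le> 1 / m"
        proof -
          have "t k - t (i * j) = (real k - real (i * j)) / real (m * j)" by (simp add: t_def diff_divide_distrib)
          also have "\<dots> \<le> real j / real (m * j)"
          proof (rule divide_right_mono)
            have "real k \<le> real (i * j + j)" using k by (intro of_nat_mono) auto
            then show "real k - real (i * j) \<le> real j" by (simp only: of_nat_add)
          qed simp
          finally show ?thesis using mj by simp
        qed
        then have "C * (t k - t (i * j)) \<le> C / m"
          using mult_left_mono[OF _ C] by fastforce
        then have close: "dist (\<psi> (t (i * j))) (\<psi> (t k)) < d"
          using lip[of "i * j" k] k ij Cm by (simp add: dist_norm norm_minus_commute)
        have "l (\<psi> (t (i * j))) (\<psi> (t (Suc k)) - \<psi> (t k)) \<le> l (\<psi> (t k)) (\<psi> (t (Suc k)) - \<psi> (t k)) + e' * norm (\<psi> (t (Suc k)) - \<psi> (t k))"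
        proof (rule d(2)[OF \<psi>K \<psi>K close])
          have "i * j \<le> k" "k < i * j + j" using k by auto
          then show "i * j \<le> m * j" "k \<le> m * j" using ij by linarith+
        qed
        moreover have step: "norm (\<psi> (t (Suc k)) - \<psi> (t k)) \<le> C * (1 / (m * j))"
          using lip[of k "Suc k"] k ij by (simp add: t_def diff_divide_distrib[symmetric])
        ultimately show "l (\<psi> (t (i * j))) (\<psi> (t (Suc k)) - \<psi> (t k)) \<le> l (\<psi> (t k)) (\<psi> (t (Suc k)) - \<psi> (t k)) + e' * (C * (1 / (m * j)))"
          using mult_left_mono[OF step, of e'] e'(1) by linarith
      qed
      also have "\<dots> = (\<Sum>k\<in>{i * j..<i * j + j}. l (\<psi> (t k)) (\<psi> (t (Suc k)) - \<psi> (t k))) + e' * C / m"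
        using mj(2) by (simp add: sum.distrib)
      also have "\<dots> \<le> (\<Sum>k\<in>{i * j..<i * j + j}. l (\<psi> (t k)) (\<psi> (t (Suc k)) - \<psi> (t k))) + e / m"
        using e'(2) by (simp add: divide_right_mono)
      finally show ?thesis .
    qed
    then have "polygonal_action l m \<psi> \<le>
      (\<Sum>i<m. (\<Sum>k\<in>{i * j..<i * j + j}. l (\<psi> (t k)) (\<psi> (t (Suc k)) - \<psi> (t k))) + e / m)"
      unfolding polygonal_action_def t_m by (intro sum_mono) auto
    also have "\<dots> = (\<Sum>k<m * j. l (\<psi> (t k)) (\<psi> (t (Suc k)) - \<psi> (t k))) + e"
      using m by (simp add: sum.distrib sum.nat_group)
    finally show ?thesis
      by (simp add: polygonal_action_def t_def)
  qed
  with m0(1) that show thesis by blast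
qed

text \<open>
  Passing to the limit over refinements bounds the polygonal action by the action, with an error
  and a threshold \<open>m0\<close> that do not depend on the curve.
\<close>

lemma polygonal_action_le_integral:
  fixes l :: "real ^ 'n::finite \<Rightarrow> real ^ 'n \<Rightarrow> real"
  assumes l: "geometric_integrand D l" and K: "compact K" "K \<subseteq> D" and e: "0 < e" and C: "0 \<le> C"
  obtains m0 where "\<And>m \<psi>. m0 \<le> m \<Longrightarrow> C-lipschitz_on {0..1} \<psi> \<Longrightarrow> \<psi> ` {0..1} \<subseteq> K \<Longrightarrow>
     ennreal (polygonal_action l m \<psi>) \<le>
       (\<integral>\<^sup>+\<alpha>\<in>{0..1}. ennreal (l (\<psi> \<alpha>) (vector_derivative \<psi> (at \<alpha>))) \<partial>lebesgue) + ennreal e"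
proof -
  obtain m0 where m0: "0 < m0" "\<And>m j \<psi>. m0 \<le> m \<Longrightarrow> 0 < j \<Longrightarrow> C-lipschitz_on {0..1} \<psi> \<Longrightarrow> \<psi> ` {0..1} \<subseteq> K \<Longrightarrow>
     polygonal_action l m \<psi> \<le> polygonal_action l (m * j) \<psi> + e"
    using polygonal_action_refine[OF l K e C] by blast
  have "ennreal (polygonal_action l m \<psi>) \<le>
       (\<integral>\<^sup>+\<alpha>\<in>{0..1}. ennreal (l (\<psi> \<alpha>) (vector_derivative \<psi> (at \<alpha>))) \<partial>lebesgue) + ennreal e" (is "_ \<le> ?I + _")
    if m: "m0 \<le> m" and \<psi>: "C-lipschitz_on {0..1} \<psi>" "\<psi> ` {0..1} \<subseteq> K" for m \<psi>
  proof -
    have mpos: "0 < m" using m0(1) m by simp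
    \<comment> \<open>The limit is stated along the indices \<open>Suc\<close>, hence the shift by one.\<close>
    have "strict_mono (\<lambda>j. m * Suc j - 1)"
      using mpos by (intro strict_monoI_Suc) (simp add: algebra_simps)
    then have "(\<lambda>j. ennreal (polygonal_action l (Suc (m * Suc j - 1)) \<psi>)) \<longlonglongrightarrow> ?I"
      using LIMSEQ_subseq_LIMSEQ[OF polygonal_action_tendsto_integral[OF l K \<psi>]] by (simp add: o_def)
    then have "(\<lambda>j. ennreal (polygonal_action l (m * Suc j) \<psi>)) \<longlonglongrightarrow> ?I"
      using mpos by simp
    then have "(\<lambda>j. ennreal (polygonal_action l (m * Suc j) \<psi>) + ennreal e) \<longlonglongrightarrow> ?I + ennreal e"
      by (intro tendsto_add tendsto_const)
    moreover have "ennreal (polygonal_action l m \<psi>) \<le> ennreal (polygonal_action l (m * Suc j) \<psi>) + ennreal e" for j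
    proof -
      have "ennreal (polygonal_action l m \<psi>) \<le> ennreal (polygonal_action l (m * Suc j) \<psi> + e)"
        using m0(2)[OF m _ \<psi>, of "Suc j"] by (intro ennreal_leI) simp
      also have "\<dots> \<le> ennreal (polygonal_action l (m * Suc j) \<psi>) + ennreal e"
        using e by (cases "0 \<le> polygonal_action l (m * Suc j) \<psi>") (auto simp: ennreal_plus ennreal_neg ennreal_leI)
      finally show ?thesis .
    qed
    ultimately show ?thesis
      by (intro LIMSEQ_le_const) auto
  qed
  then show thesis using that by blast
qed

section \<open>Lipschitz parameterizations of rectifiable curves\<close>

lemma abs_continuous_on_Lipschitz:
  assumes "C-lipschitz_on I f"
  shows "abs_continuous_on I f"
  unfolding abs_continuous_on_def
proof (intro allI impI)
  fix e :: real assume e: "0 < e"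
  have C: "0 \<le> C" using assms by (rule lipschitz_on_nonneg)
  show "\<exists>d>0. \<forall>\<D>. \<D> division_of \<Union> \<D> \<and> \<Union> \<D> \<subseteq> I \<and> (\<Sum>k\<in>\<D>. Sup k - Inf k) < d \<longrightarrow>
      (\<Sum>k\<in>\<D>. dist (f (Inf k)) (f (Sup k))) < e"
  proof (intro exI[of _ "e / (C + 1)"] conjI allI impI)
    show "0 < e / (C + 1)" using e C by simp
    fix \<D> :: "real set set"
    assume \<D>: "\<D> division_of \<Union> \<D> \<and> \<Union> \<D> \<subseteq> I \<and> (\<Sum>k\<in>\<D>. Sup k - Inf k) < e / (C + 1)"
    have k: "Inf k \<in> I" "Sup k \<in> I" "Inf k \<le> Sup k" if "k \<in> \<D>" for k
    proof -
      obtain a b where "k = cbox a b" "k \<noteq> {}"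
        using \<D> \<open>k \<in> \<D>\<close> division_ofD(3,4) by metis
      then have "k = {a..b}" "a \<le> b" by auto
      then have "Inf k \<in> k" "Sup k \<in> k" "Inf k \<le> Sup k"
        by auto
      then show "Inf k \<in> I" "Sup k \<in> I" "Inf k \<le> Sup k" using \<D> \<open>k \<in> \<D>\<close> by auto
    qed
    have "(\<Sum>k\<in>\<D>. dist (f (Inf k)) (f (Sup k))) \<le> (\<Sum>k\<in>\<D>. C * (Sup k - Inf k))"
    proof (rule sum_mono)
      fix k assume "k \<in> \<D>"
      then show "dist (f (Inf k)) (f (Sup k)) \<le> C * (Sup k - Inf k)"
        using lipschitz_onD[OF assms k(1,2), of k k] k(3)[of k] by (simp add: dist_real_def)
    qed
    also have "\<dots> \<le> (C + 1) * (\<Sum>k\<in>\<D>. Sup k - Inf k)"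
      unfolding sum_distrib_left using k(3) C by (intro sum_mono mult_right_mono) auto
    also have "\<dots> < e"
      using \<D> C by (simp add: field_simps)
    finally show "(\<Sum>k\<in>\<D>. dist (f (Inf k)) (f (Sup k))) < e" .
  qed
qed

lemma C_tilde_Lipschitz:
  assumes "C-lipschitz_on {0..1} \<phi>" "\<phi> ` {0..1} \<subseteq> D"
  shows "\<phi> \<in> C_tilde D"
proof -
  have "abs_continuous_on (cball \<alpha> 1 \<inter> {0..1}) \<phi>" for \<alpha>
    using assms(1) by (intro abs_continuous_on_Lipschitz) (rule lipschitz_on_subset, auto)
  then have "\<exists>F. finite F \<and> F \<subseteq> {0..1} \<and> (\<forall>\<alpha>\<in>{0..1} - F. \<exists>r>0. abs_continuous_on (cball \<alpha> r \<inter> {0..1}) \<phi>)"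
    by (intro exI[of _ "{}"]) (auto intro: exI[of _ 1])
  then show ?thesis
    using assms lipschitz_on_continuous_on unfolding C_tilde_def by blast
qed

lemma param_length_Lipschitz:
  assumes \<phi>: "C-lipschitz_on {0..T} \<phi>"
  shows "param_length (T, \<phi>) \<le> ennreal (C * T)"
  unfolding param_length_def
proof (rule SUP_least, clarsimp)
  fix t :: "nat \<Rightarrow> real" and N :: nat
  assume t: "mono t" "range t \<subseteq> {0..T}"
  have C: "0 \<le> C" using \<phi> by (rule lipschitz_on_nonneg)
  have ti: "t i \<in> {0..T}" for i using t(2) by blast
  have "(\<Sum>i<N. dist (\<phi> (t i)) (\<phi> (t (Suc i)))) \<le> (\<Sum>i<N. C * (t (Suc i) - t i))"
  proof (rule sum_mono)
    fix i
    have "t i \<le> t (Suc i)" using t(1) by (simp add: monoD)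
    then show "dist (\<phi> (t i)) (\<phi> (t (Suc i))) \<le> C * (t (Suc i) - t i)"
      using lipschitz_onD[OF \<phi> ti ti, of i "Suc i"] by (simp add: dist_real_def)
  qed
  also have "\<dots> = C * (t N - t 0)"
    unfolding sum_distrib_left[symmetric] by (simp add: sum_lessThan_telescope)
  also have "\<dots> \<le> C * T"
    using ti[of N] ti[of 0] C by (intro mult_left_mono) auto
  finally show "ennreal (\<Sum>i<N. dist (\<phi> (t i)) (\<phi> (t (Suc i)))) \<le> ennreal (C * T)"
    by (rule ennreal_leI)
qed

text \<open>
  Any chain of points in \<open>[0, s]\<close> can be prolonged by \<open>s\<close> and \<open>t\<close>.
\<close>

lemma param_length_add_dist_le:
  assumes st: "0 \<le> s" "s \<le> t"
  shows "param_length (s, \<phi>) + ennreal (dist (\<phi> s) (\<phi> t)) \<le> param_length (t, \<phi>)"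
proof -
  let ?A = "{t. mono t \<and> range t \<subseteq> {0..s}} \<times> (UNIV :: nat set)"
  let ?f = "\<lambda>(u, N). ennreal (\<Sum>i<N. dist (\<phi> (u i)) (\<phi> (u (Suc i))))"
  have ne: "?A \<noteq> {}"
    using st by (auto intro!: exI[of _ "\<lambda>_. 0"] simp: mono_def)
  have "param_length (s, \<phi>) + ennreal (dist (\<phi> s) (\<phi> t)) = (SUP x\<in>?A. ?f x + ennreal (dist (\<phi> s) (\<phi> t)))"
    unfolding param_length_def by (subst ennreal_SUP_add_left[OF ne]) (auto simp: case_prod_unfold)
  also have "\<dots> \<le> param_length (t, \<phi>)"
  proof (rule SUP_least, clarify)
    fix u :: "nat \<Rightarrow> real" and N :: nat
    assume u: "mono u" "range u \<subseteq> {0..s}"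
    define v where "v = (\<lambda>i. if i \<le> N then u i else if i = Suc N then s else t)"
    have us: "0 \<le> u i" "u i \<le> s" for i using u(2) by (auto simp: image_subset_iff)
    have "mono v"
      using u(1) us st order_trans[OF us(2) st(2)] by (auto simp: v_def mono_def)
    moreover have "range v \<subseteq> {0..t}"
      using us st order_trans[OF us(2) st(2)] by (auto simp: v_def)
    ultimately have "(v, Suc (Suc N)) \<in> {u. mono u \<and> range u \<subseteq> {0..t}} \<times> UNIV" by auto
    then have "ennreal (\<Sum>i<Suc (Suc N). dist (\<phi> (v i)) (\<phi> (v (Suc i)))) \<le> param_length (t, \<phi>)"
      unfolding param_length_def fst_conv snd_conv by (rule SUP_upper2) simp
    moreover have "(\<Sum>i<N. dist (\<phi> (v i)) (\<phi> (v (Suc i)))) = (\<Sum>i<N. dist (\<phi> (u i)) (\<phi> (u (Suc i))))"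
      by (intro sum.cong) (auto simp: v_def)
    moreover have "dist (\<phi> (v (Suc N))) (\<phi> (v (Suc (Suc N)))) = dist (\<phi> s) (\<phi> t)"
      by (simp add: v_def)
    then have "(\<Sum>i<N. dist (\<phi> (u i)) (\<phi> (u (Suc i)))) + dist (\<phi> s) (\<phi> t)
        \<le> (\<Sum>i<Suc (Suc N). dist (\<phi> (v i)) (\<phi> (v (Suc i))))"
      using \<open>(\<Sum>i<N. dist (\<phi> (v i)) (\<phi> (v (Suc i)))) = _\<close> by simp
    ultimately have "ennreal ((\<Sum>i<N. dist (\<phi> (u i)) (\<phi> (u (Suc i)))) + dist (\<phi> s) (\<phi> t)) \<le> param_length (t, \<phi>)"
      by (meson ennreal_leI order_trans)
    then show "ennreal (\<Sum>i<N. dist (\<phi> (u i)) (\<phi> (u (Suc i)))) + ennreal (dist (\<phi> s) (\<phi> t)) \<le> param_length (t, \<phi>)"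
      by (simp add: ennreal_plus sum_nonneg)
  qed
  finally show ?thesis .
qed

lemma param_length_mono:
  assumes "0 \<le> s" "s \<le> t"
  shows "param_length (s, \<phi>) \<le> param_length (t, \<phi>)"
proof (rule order_trans)
  show "param_length (s, \<phi>) \<le> param_length (s, \<phi>) + ennreal (dist (\<phi> s) (\<phi> t))" by simp
qed (rule param_length_add_dist_le[OF assms])

text \<open>
  The function \<open>W\<close> stands for arc length plus \<open>\<eta>\<close> times the parameter.  It may jump, so the
  reparameterization is its generalized inverse \<open>\<sigma>\<close>, rescaled to \<open>[0, 1]\<close>: since \<open>W\<close> grows at least
  at rate \<open>\<eta>\<close>, \<open>\<sigma>\<close> is Lipschitz, in particular continuous.  A jump of \<open>W\<close> yields an
  interval on which \<open>\<sigma>\<close> is constant, so that \<open>\<phi> \<circ> \<sigma>\<close> remains Lipschitz; this makes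
  it unnecessary to know that arc length is continuous.
\<close>

lemma Lipschitz_reparametrization:
  fixes \<phi> :: "real \<Rightarrow> 'a::metric_space" and W :: "real \<Rightarrow> real"
  assumes T: "0 < T" and \<eta>: "0 < \<eta>" and \<phi>: "continuous_on {0..T} \<phi>" and W0: "W 0 = 0" "W T = C"
    and W: "\<And>s t. 0 \<le> s \<Longrightarrow> s \<le> t \<Longrightarrow> t \<le> T \<Longrightarrow> dist (\<phi> s) (\<phi> t) + \<eta> * (t - s) \<le> W t - W s"
  obtains a where "a \<in> reparams T" "C-lipschitz_on {0..1} (\<phi> \<circ> a)"
proof -
  have W_mono: "W s \<le> W t" if "0 \<le> s" "s \<le> t" "t \<le> T" for s t
  proof -
    have "0 \<le> dist (\<phi> s) (\<phi> t) + \<eta> * (t - s)" using \<eta> that by simp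
    then show ?thesis using W[OF that] by linarith
  qed
  have "0 < \<eta> * T" using T \<eta> by simp
  moreover have "dist (\<phi> 0) (\<phi> T) + \<eta> * T \<le> C" using W[of 0 T] W0 T by simp
  ultimately have C: "0 < C" using zero_le_dist[of "\<phi> 0" "\<phi> T"] by linarith
  define \<sigma> where "\<sigma> = (\<lambda>x. Sup {t \<in> {0..T}. W t \<le> x})"
  have ne: "0 \<in> {t \<in> {0..T}. W t \<le> x}" if "0 \<le> x" for x
    using that T W0 by simp
  have bdd: "bdd_above {t \<in> {0..T}. W t \<le> x}" for x
    by (rule bdd_aboveI[of _ T]) auto
  have \<sigma>_ge: "t \<le> \<sigma> x" if "t \<in> {0..T}" "W t \<le> x" for t x
    unfolding \<sigma>_def using that by (intro cSup_upper bdd) auto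
  have \<sigma>_le: "\<sigma> x \<le> u" if "0 \<le> x" "\<And>t. t \<in> {0..T} \<Longrightarrow> W t \<le> x \<Longrightarrow> t \<le> u" for x u
    unfolding \<sigma>_def using ne[OF that(1)] that(2) by (intro cSup_least) auto
  have \<sigma>_in: "\<sigma> x \<in> {0..T}" if "0 \<le> x" for x
    using \<sigma>_ge[of 0 x] \<sigma>_le[of x T] that T W0 by auto
  have \<sigma>_mono: "\<sigma> x \<le> \<sigma> y" if "0 \<le> x" "x \<le> y" for x y
    using that by (intro \<sigma>_le) (auto intro: \<sigma>_ge)
  have \<sigma>_W: "\<sigma> (W t) = t" if t: "t \<in> {0..T}" for t
  proof (rule antisym)
    have "0 \<le> W t" using W_mono[of 0 t] W0 t by simp
    then show "\<sigma> (W t) \<le> t"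
    proof (rule \<sigma>_le)
      fix u assume u: "u \<in> {0..T}" "W u \<le> W t"
      show "u \<le> t"
      proof (rule ccontr)
        assume "\<not> u \<le> t"
        then have "0 < \<eta> * (u - t)" using \<eta> by simp
        then show False using W[of t u] t u \<open>\<not> u \<le> t\<close> zero_le_dist[of "\<phi> t" "\<phi> u"] by (auto simp del: zero_le_dist)
      qed
    qed
  qed (use t in \<open>auto intro: \<sigma>_ge\<close>)
  \<comment> \<open>At parameters strictly between \<open>\<sigma> x\<close> and \<open>\<sigma> y\<close>, the values of \<open>W\<close> lie between \<open>x\<close> and \<open>y\<close>.\<close>
  have \<sigma>_between: "dist (\<phi> u) (\<phi> v) + \<eta> * (v - u) \<le> y - x"
    if "0 \<le> x" "x \<le> y" "\<sigma> x < u" "u \<le> v" "v < \<sigma> y" for x y u v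
  proof -
    have y: "0 \<le> y" using that by simp
    have uv: "0 \<le> u" "v \<le> T" using that \<sigma>_in[of x] \<sigma>_in[OF y] by auto
    have "x < W u" using \<sigma>_ge[of u x] that uv by force
    moreover have "W v \<le> y"
    proof (rule ccontr)
      assume "\<not> W v \<le> y"
      have "t \<le> v" if "t \<in> {0..T}" "W t \<le> y" for t
        using W_mono[of v t] that uv \<open>u \<le> v\<close> \<open>\<not> W v \<le> y\<close> by fastforce
      then have "\<sigma> y \<le> v" using \<sigma>_le[OF y] by blast
      then show False using that by simp
    qed
    ultimately show ?thesis using W[of u v] uv that by linarith
  qed
  have \<sigma>_lip: "dist (\<phi> (\<sigma> x)) (\<phi> (\<sigma> y)) + \<eta> * (\<sigma> y - \<sigma> x) \<le> y - x" if xy: "0 \<le> x" "x \<le> y" for x y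
  proof (cases "\<sigma> x = \<sigma> y")
    case False
    define p q where "p = \<sigma> x" and "q = \<sigma> y"
    have pq: "p < q" "p \<in> {0..T}" "q \<in> {0..T}"
      using False \<sigma>_mono[OF xy] \<sigma>_in[of x] \<sigma>_in[of y] xy by (auto simp: p_def q_def)
    \<comment> \<open>The end points themselves are reached by continuity of \<open>\<phi>\<close>.\<close>
    define u v where "u = (\<lambda>n. p + (q - p) / 2 * inverse (real (Suc n)))" and "v = (\<lambda>n. q - (q - p) / 2 * inverse (real (Suc n)))"
    have "u \<longlonglongrightarrow> p + (q - p) / 2 * 0" "v \<longlonglongrightarrow> q - (q - p) / 2 * 0"
      unfolding u_def v_def by (intro tendsto_intros LIMSEQ_inverse_real_of_nat)+
    then have lim: "u \<longlonglongrightarrow> p" "v \<longlonglongrightarrow> q" by auto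
    have uv: "p < u n" "u n \<le> v n" "v n < q" for n
    proof -
      have i: "0 < inverse (real (Suc n))" "inverse (real (Suc n)) \<le> 1" by (auto simp: field_simps)
      have "0 < (q - p) / 2 * inverse (real (Suc n))" using i(1) pq(1) by (intro mult_pos_pos) auto
      moreover have "(q - p) / 2 * inverse (real (Suc n)) \<le> (q - p) / 2"
        using mult_left_mono[OF i(2), of "(q - p) / 2"] pq(1) by simp
      moreover have "p + (q - p) / 2 = q - (q - p) / 2" by (simp add: field_simps)
      ultimately show "p < u n" "u n \<le> v n" "v n < q" unfolding u_def v_def by linarith+
    qed
    have in_T: "u n \<in> {0..T}" "v n \<in> {0..T}" for n
      using pq uv[of n] by auto
    have "(\<lambda>n. \<phi> (u n)) \<longlonglongrightarrow> \<phi> p"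
      by (rule continuous_on_tendsto_compose[OF \<phi> lim(1)]) (use pq in_T in auto)
    moreover have "(\<lambda>n. \<phi> (v n)) \<longlonglongrightarrow> \<phi> q"
      by (rule continuous_on_tendsto_compose[OF \<phi> lim(2)]) (use pq in_T in auto)
    ultimately have "(\<lambda>n. dist (\<phi> (u n)) (\<phi> (v n)) + \<eta> * (v n - u n)) \<longlonglongrightarrow> dist (\<phi> p) (\<phi> q) + \<eta> * (q - p)"
      by (intro tendsto_intros lim)
    then show ?thesis
      unfolding p_def[symmetric] q_def[symmetric]
      by (rule LIMSEQ_le_const2) (use \<sigma>_between[OF xy] uv p_def q_def in auto)
  qed (use xy in simp)
  have \<sigma>_le': "\<eta> * (\<sigma> y - \<sigma> x) \<le> y - x" "dist (\<phi> (\<sigma> x)) (\<phi> (\<sigma> y)) \<le> y - x" if "0 \<le> x" "x \<le> y" for x y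
  proof -
    have "0 \<le> \<eta> * (\<sigma> y - \<sigma> x)" using \<sigma>_mono[OF that] \<eta> by simp
    then show "\<eta> * (\<sigma> y - \<sigma> x) \<le> y - x" "dist (\<phi> (\<sigma> x)) (\<phi> (\<sigma> y)) \<le> y - x"
      using \<sigma>_lip[OF that] zero_le_dist[of "\<phi> (\<sigma> x)" "\<phi> (\<sigma> y)"] by linarith+
  qed
  define a where "a = (\<lambda>\<tau>. \<sigma> (C * \<tau>))"
  have Cm: "0 \<le> C * x" "C * x \<le> C * y" if "0 \<le> x" "x \<le> y" for x y
    using C that by auto
  have a_mono: "a x \<le> a y" if "0 \<le> x" "x \<le> y" for x y
    unfolding a_def by (rule \<sigma>_mono[OF Cm[OF that]])
  have "(C / \<eta>)-lipschitz_on {0..1} a"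
  proof (rule lipschitz_on_leI)
    fix x y :: real assume "x \<in> {0..1}" "y \<in> {0..1}" "x \<le> y"
    then have xy: "0 \<le> x" "x \<le> y" by auto
    show "dist (a x) (a y) \<le> C / \<eta> * dist x y"
      using \<sigma>_le'(1)[OF Cm[OF xy]] a_mono[OF xy] xy \<eta> by (simp add: a_def dist_real_def field_simps)
  qed (use C \<eta> in simp)
  then have a_cont: "continuous_on {0..1} a" by (rule lipschitz_on_continuous_on)
  have a_ends: "a 0 = 0" "a 1 = T"
    using \<sigma>_W[of 0] \<sigma>_W[of T] T W0 by (auto simp: a_def)
  have "a ` {0..1} = {0..T}"
  proof
    show "a ` {0..1} \<subseteq> {0..T}" using a_ends a_mono[of 0] a_mono[of _ 1] by fastforce
    show "{0..T} \<subseteq> a ` {0..1}"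
    proof
      fix y assume "y \<in> {0..T}"
      then show "y \<in> a ` {0..1}" using IVT'[of a 0 y 1] a_cont a_ends by auto
    qed
  qed
  then have "a \<in> reparams T"
    using a_cont a_mono by (auto simp: reparams_def mono_on_def)
  moreover have "C-lipschitz_on {0..1} (\<phi> \<circ> a)"
  proof (rule lipschitz_on_leI)
    fix x y :: real assume "x \<in> {0..1}" "y \<in> {0..1}" "x \<le> y"
    then have xy: "0 \<le> x" "x \<le> y" by auto
    show "dist ((\<phi> \<circ> a) x) ((\<phi> \<circ> a) y) \<le> C * dist x y"
      using \<sigma>_le'(2)[OF Cm[OF xy]] xy by (simp add: a_def dist_real_def algebra_simps)
  qed (use C in simp)
  ultimately show thesis using that by blast
qed

lemma frechet_equiv_reparam:
  assumes p: "(T, \<phi>) \<in> params D" and a: "a \<in> reparams T"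
  shows "((T, \<phi>), (1, \<phi> \<circ> a)) \<in> frechet_equiv D"
proof -
  have ac: "continuous_on {0..1} a" "a ` {0..1} = {0..T}" using a by (auto simp: reparams_def)
  have "(\<phi> \<circ> a) ` {0..1} = \<phi> ` {0..T}" by (simp only: image_comp[symmetric] ac(2))
  then have q: "(1, \<phi> \<circ> a) \<in> params D"
    using p ac continuous_on_compose[of "{0..1}" a \<phi>] by (simp add: params_def del: comp_apply)
  have "frechet_dist (T, \<phi>) (1, \<phi> \<circ> a) = 0"
    unfolding frechet_dist_0_iff[OF p q]
  proof (intro allI impI)
    fix e :: real assume "0 < e"
    then show "\<exists>a'\<in>reparams (fst (T, \<phi>)). \<exists>b\<in>reparams (fst (1, \<phi> \<circ> a)).
        \<forall>t\<in>{0..1}. dist (snd (T, \<phi>) (a' t)) (snd (1, \<phi> \<circ> a) (b t)) < e"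
      using a reparams_scale[of 1] by (intro bexI[of _ a] bexI[of _ "\<lambda>t. 1 * t"]) simp_all
  qed
  then show ?thesis using p q by (simp add: frechet_equiv_def)
qed

lemma curve_mem_iff:
  assumes "\<gamma> \<in> curves D" "p \<in> \<gamma>"
  shows "q \<in> \<gamma> \<longleftrightarrow> (p, q) \<in> frechet_equiv D"
proof -
  obtain r where r: "\<gamma> = frechet_equiv D `` {r}" "r \<in> params D"
    using assms(1) by (auto simp: curves_def elim: quotientE)
  then have "(r, p) \<in> frechet_equiv D" using assms(2) by simp
  then have "\<gamma> = frechet_equiv D `` {p}"
    using r equiv_class_eq[OF equiv_frechet_equiv] by metis
  then show ?thesis by simp
qed

lemma curve_nonempty:
  assumes "\<gamma> \<in> curves D"
  obtains T \<phi> where "(T, \<phi>) \<in> \<gamma>" "(T, \<phi>) \<in> params D"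
proof -
  have "\<gamma> \<noteq> {}" "\<gamma> \<subseteq> params D"
    using in_quotient_imp_non_empty[OF equiv_frechet_equiv assms[unfolded curves_def]]
      in_quotient_imp_subset[OF equiv_frechet_equiv assms[unfolded curves_def]] by blast+
  then show thesis using that by fastforce
qed

text \<open>
  Constant speed would allow \<open>\<epsilon> = 0\<close>.  Admitting an arbitrarily small loss avoids the
  continuity of arc length and costs nothing in the limit.
\<close>

lemma rectifiable_curve_Lipschitz_param:
  assumes \<gamma>: "\<gamma> \<in> Gam D" and \<epsilon>: "0 < \<epsilon>"
  obtains \<psi> where "(1, \<psi>) \<in> \<gamma>" "(enn2real (curve_length \<gamma>) + \<epsilon>)-lipschitz_on {0..1} \<psi>"
proof -
  have \<gamma>c: "\<gamma> \<in> curves D" and fin: "curve_length \<gamma> < \<infinity>" using \<gamma> by (auto simp: Gam_def)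
  obtain T \<phi> where \<phi>: "(T, \<phi>) \<in> \<gamma>" "(T, \<phi>) \<in> params D"
    using curve_nonempty[OF \<gamma>c] by blast
  have T: "0 < T" and cont: "continuous_on {0..T} \<phi>" using \<phi>(2) by (auto simp: params_def)
  have len: "curve_length \<gamma> = param_length (T, \<phi>)" using curve_eqs(3)[OF \<gamma>c \<phi>(1)] .
  define V where "V = (\<lambda>t. enn2real (param_length (t, \<phi>)))"
  have V: "dist (\<phi> s) (\<phi> t) \<le> V t - V s" if "0 \<le> s" "s \<le> t" "t \<le> T" for s t
  proof -
    have ft: "param_length (t, \<phi>) < \<infinity>" and fs: "param_length (s, \<phi>) < \<infinity>"
      using param_length_mono[of t T \<phi>] param_length_mono[of s T \<phi>] that fin len by auto
    have *: "param_length (s, \<phi>) + ennreal (dist (\<phi> s) (\<phi> t)) \<le> param_length (t, \<phi>)"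
      using param_length_add_dist_le that by blast
    have "enn2real (param_length (s, \<phi>) + ennreal (dist (\<phi> s) (\<phi> t))) \<le> V t"
      unfolding V_def using * ft by (intro enn2real_mono) auto
    then show ?thesis
      using fs by (simp add: V_def enn2real_plus)
  qed
  have V0: "V 0 = 0"
  proof -
    have "param_length (0, \<phi>) \<le> ennreal (0 * 0)"
      by (intro param_length_Lipschitz) (auto simp: lipschitz_on_def)
    then show ?thesis by (simp add: V_def)
  qed
  have "dist (\<phi> s) (\<phi> t) + \<epsilon> / T * (t - s) \<le> (V t + \<epsilon> / T * t) - (V s + \<epsilon> / T * s)" if "0 \<le> s" "s \<le> t" "t \<le> T" for s t
    using V[OF that] by (simp add: right_diff_distrib)
  then obtain a where a: "a \<in> reparams T" "(V T + \<epsilon>)-lipschitz_on {0..1} (\<phi> \<circ> a)"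
    using Lipschitz_reparametrization[of T "\<epsilon> / T" \<phi> "\<lambda>t. V t + \<epsilon> / T * t" "V T + \<epsilon>"] T \<epsilon> cont V0 by auto
  have "(1, \<phi> \<circ> a) \<in> \<gamma>"
    using curve_mem_iff[OF \<gamma>c \<phi>(1)] frechet_equiv_reparam[OF \<phi>(2) a(1)] by blast
  with a(2) show thesis
    using that[of "\<phi> \<circ> a"] by (simp add: len V_def)
qed

section \<open>Lower semicontinuity and existence of a minimizer\<close>

text \<open>
  A Lipschitz parameterization is absolutely continuous, so it may be used to evaluate the action.
\<close>

lemma geometric_action_eq_integral:
  assumes S: "\<forall>\<gamma>\<in>Gam_tilde D. \<forall>\<phi>\<in>C_tilde D. (1, \<phi>) \<in> \<gamma> \<longrightarrow>
           S \<gamma> = (\<integral>\<^sup>+\<alpha>\<in>{0..1}. ennreal (l (\<phi> \<alpha>) (vector_derivative \<phi> (at \<alpha>))) \<partial>lebesgue)"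
    and \<gamma>: "\<gamma> \<in> curves D" "(1, \<phi>) \<in> \<gamma>"
    and \<phi>: "C-lipschitz_on {0..1} \<phi>" "\<phi> ` {0..1} \<subseteq> D"
  shows "S \<gamma> = (\<integral>\<^sup>+\<alpha>\<in>{0..1}. ennreal (l (\<phi> \<alpha>) (vector_derivative \<phi> (at \<alpha>))) \<partial>lebesgue)"
proof -
  have "\<phi> \<in> C_tilde D" using C_tilde_Lipschitz[OF \<phi>] .
  moreover from this have "\<gamma> \<in> Gam_tilde D" using \<gamma> by (auto simp: Gam_tilde_def)
  ultimately show ?thesis using S \<gamma>(2) by blast
qed

text \<open>
  For a fixed division the polygonal action is continuous under pointwise convergence.  It is
  bounded by the action of each \<open>\<psi> n\<close> up to a uniform error and converges to the action of \<open>\<phi>\<close> as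
  the division becomes finer.
\<close>

lemma geometric_integral_lower_semicontinuous:
  fixes \<psi> :: "nat \<Rightarrow> real \<Rightarrow> real ^ 'n::finite"
  assumes l: "geometric_integrand D l" and K: "compact K" "K \<subseteq> D"
    and \<psi>: "\<And>n. C-lipschitz_on {0..1} (\<psi> n)" "\<And>n. \<psi> n ` {0..1} \<subseteq> K"
    and \<phi>: "C-lipschitz_on {0..1} \<phi>" "\<phi> ` {0..1} \<subseteq> K"
    and conv: "\<And>x. x \<in> {0..1} \<Longrightarrow> (\<lambda>n. \<psi> n x) \<longlonglongrightarrow> \<phi> x"
    and I: "(\<lambda>n. \<integral>\<^sup>+\<alpha>\<in>{0..1}. ennreal (l (\<psi> n \<alpha>) (vector_derivative (\<psi> n) (at \<alpha>))) \<partial>lebesgue) \<longlonglongrightarrow> I"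
  shows "(\<integral>\<^sup>+\<alpha>\<in>{0..1}. ennreal (l (\<phi> \<alpha>) (vector_derivative \<phi> (at \<alpha>))) \<partial>lebesgue) \<le> I"
proof (rule ennreal_le_epsilon)
  fix e :: real assume e: "0 < e"
  have C: "0 \<le> C" using \<phi>(1) by (rule lipschitz_on_nonneg)
  obtain m0 where m0: "\<And>m \<psi>. m0 \<le> m \<Longrightarrow> C-lipschitz_on {0..1} \<psi> \<Longrightarrow> \<psi> ` {0..1} \<subseteq> K \<Longrightarrow>
     ennreal (polygonal_action l m \<psi>) \<le>
       (\<integral>\<^sup>+\<alpha>\<in>{0..1}. ennreal (l (\<psi> \<alpha>) (vector_derivative \<psi> (at \<alpha>))) \<partial>lebesgue) + ennreal e"
    using polygonal_action_le_integral[OF l K e C] by blast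
  have poly_conv: "(\<lambda>n. polygonal_action l m (\<psi> n)) \<longlonglongrightarrow> polygonal_action l m \<phi>" for m
    unfolding polygonal_action_def
  proof (rule tendsto_sum)
    fix i assume "i \<in> {..<m}"
    then have i: "real i / real m \<in> {0..1}" "real (Suc i) / real m \<in> {0..1}" by auto
    have "\<psi> n (real i / real m) \<in> D" "\<phi> (real i / real m) \<in> D" for n
      using i(1) \<psi>(2)[of n] \<phi>(2) K by blast+
    then show "(\<lambda>n. l (\<psi> n (real i / real m)) (\<psi> n (real (Suc i) / real m) - \<psi> n (real i / real m)))
      \<longlonglongrightarrow> l (\<phi> (real i / real m)) (\<phi> (real (Suc i) / real m) - \<phi> (real i / real m))"
      by (intro geometric_integrand_tendsto[OF l] tendsto_diff conv i)
  qed
  have "ennreal (polygonal_action l m \<phi>) \<le> I + ennreal e" if "m0 \<le> m" for m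
  proof (rule LIMSEQ_le)
    show "(\<lambda>n. ennreal (polygonal_action l m (\<psi> n))) \<longlonglongrightarrow> ennreal (polygonal_action l m \<phi>)"
      by (intro tendsto_ennrealI poly_conv)
    show "(\<lambda>n. (\<integral>\<^sup>+\<alpha>\<in>{0..1}. ennreal (l (\<psi> n \<alpha>) (vector_derivative (\<psi> n) (at \<alpha>))) \<partial>lebesgue) + ennreal e)
        \<longlonglongrightarrow> I + ennreal e"
      by (intro tendsto_add I tendsto_const)
  qed (use m0[OF that \<psi>] in blast)
  then have "\<exists>N. \<forall>m\<ge>N. ennreal (polygonal_action l (Suc m) \<phi>) \<le> I + ennreal e"
    by (intro exI[of _ m0]) auto
  then show "(\<integral>\<^sup>+\<alpha>\<in>{0..1}. ennreal (l (\<phi> \<alpha>) (vector_derivative \<phi> (at \<alpha>))) \<partial>lebesgue) \<le> I + ennreal e"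
    by (rule LIMSEQ_le_const2[OF polygonal_action_tendsto_integral[OF l K \<phi>]])
qed

text \<open>
  The limit inherits the limit \<open>\<Lambda>\<close> of the Lipschitz constants, not merely a common bound for them;
  this is what controls the length of the minimizer.
\<close>

lemma Lipschitz_sequence_compactness:
  fixes \<psi> :: "nat \<Rightarrow> real \<Rightarrow> real ^ 'n::finite"
  assumes K: "compact K" and \<psi>: "\<And>n. (c n)-lipschitz_on {0..1} (\<psi> n)" "\<And>n. \<psi> n ` {0..1} \<subseteq> K"
    and c: "c \<longlonglongrightarrow> \<Lambda>"
  obtains k \<phi> where "strict_mono (k :: nat \<Rightarrow> nat)" "\<Lambda>-lipschitz_on {0..1} \<phi>" "\<phi> ` {0..1} \<subseteq> K"
    "\<forall>x\<in>{0..1}. (\<lambda>n. \<psi> (k n) x) \<longlonglongrightarrow> \<phi> x"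
proof -
  obtain M where M: "\<And>x. x \<in> K \<Longrightarrow> norm x \<le> M"
    using compact_imp_bounded[OF K] by (auto simp: bounded_iff)
  obtain C where C: "0 < C" "\<And>n. norm (c n) \<le> C"
    using convergent_imp_Bseq[OF convergentI[OF c]] by (auto simp: Bseq_def)
  have bound: "norm (\<psi> n x) \<le> M" if "x \<in> {0..1}" for n x
    using M \<psi>(2)[of n] that by blast
  have equi: "\<exists>d. 0 < d \<and> (\<forall>n y. y \<in> {0..1} \<and> norm (x - y) < d \<longrightarrow> norm (\<psi> n x - \<psi> n y) < e)"
    if x: "x \<in> {0..1}" "0 < e" for x e
  proof (intro exI[of _ "e / C"] conjI allI impI)
    show "0 < e / C" using x C by simp
    fix n y assume y: "y \<in> {0..1} \<and> norm (x - y) < e / C"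
    have "norm (\<psi> n x - \<psi> n y) \<le> c n * norm (x - y)"
      using lipschitz_onD[OF \<psi>(1) x(1), of y n] y by (simp add: dist_norm)
    also have "\<dots> \<le> C * norm (x - y)"
      using C(2)[of n] by (intro mult_right_mono) auto
    also have "\<dots> < e" using y C by (simp add: field_simps)
    finally show "norm (\<psi> n x - \<psi> n y) < e" .
  qed
  obtain k \<phi> where k: "strict_mono (k :: nat \<Rightarrow> nat)"
    and unif: "\<And>e. 0 < e \<Longrightarrow> \<exists>N. \<forall>n x. N \<le> n \<and> x \<in> {0..1} \<longrightarrow> norm (\<psi> (k n) x - \<phi> x) < e"
  proof (rule Arzela_Ascoli[of "{0..1}" \<psi> M])
    fix \<phi> :: "real \<Rightarrow> real ^ 'n" and k :: "nat \<Rightarrow> nat"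
    assume "strict_mono k" "\<And>e. 0 < e \<Longrightarrow> \<exists>N. \<forall>n x. N \<le> n \<and> x \<in> {0..1} \<longrightarrow> norm (\<psi> (k n) x - \<phi> x) < e"
    then show thesis by (rule that)
  qed (use bound equi in auto)
  have conv: "(\<lambda>n. \<psi> (k n) x) \<longlonglongrightarrow> \<phi> x" if "x \<in> {0..1}" for x
    by (rule LIMSEQ_I) (use unif that in blast)
  have ck: "(\<lambda>n. c (k n)) \<longlonglongrightarrow> \<Lambda>"
    using LIMSEQ_subseq_LIMSEQ[OF c k] by (simp add: o_def)
  have "\<Lambda>-lipschitz_on {0..1} \<phi>"
  proof (rule lipschitz_onI)
    fix x y :: real assume xy: "x \<in> {0..1}" "y \<in> {0..1}"
    show "dist (\<phi> x) (\<phi> y) \<le> \<Lambda> * dist x y"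
    proof (rule LIMSEQ_le)
      show "(\<lambda>n. dist (\<psi> (k n) x) (\<psi> (k n) y)) \<longlonglongrightarrow> dist (\<phi> x) (\<phi> y)"
        by (intro tendsto_dist conv xy)
      show "(\<lambda>n. c (k n) * dist x y) \<longlonglongrightarrow> \<Lambda> * dist x y"
        by (intro tendsto_mult ck tendsto_const)
    qed (use lipschitz_onD[OF \<psi>(1) xy] in auto)
  next
    show "0 \<le> \<Lambda>"
      by (rule LIMSEQ_le_const[OF c]) (use lipschitz_on_nonneg[OF \<psi>(1)] in auto)
  qed
  moreover have "\<phi> ` {0..1} \<subseteq> K"
  proof clarify
    fix x :: real assume x: "x \<in> {0..1}"
    have "\<psi> (k n) x \<in> K" for n using \<psi>(2) x by blast
    then show "\<phi> x \<in> K"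
      using closed_sequentially[OF compact_imp_closed[OF K] _ conv[OF x]] by blast
  qed
  ultimately show thesis using that k conv by blast
qed

lemma strong_minimizer_exists:
  fixes D D' A1 A2 K :: "(real ^ 'n::finite) set"
  assumes "geometric_action D S" and KD: "K \<subseteq> D" and "K \<subseteq> D'"
    and "closedin (top_of_set D) A1" and "closedin (top_of_set D) A2" and "compact K"
    and "minimizing_sequence (Gam_from_to D D' A1 A2) S \<gamma>"
    and \<gamma>_K: "\<And>n. curve_image (\<gamma> n) \<subseteq> K"
    and bounded_length: "(SUP n. curve_length (\<gamma> n)) < \<infinity>"
  shows "\<exists>\<gamma>'. strong_minimizer (Gam_from_to D D' A1 A2) S \<gamma>' \<and>
           curve_length \<gamma>' \<le> liminf (\<lambda>n. curve_length (\<gamma> n))"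
proof -
  let ?G = "Gam_from_to D D' A1 A2"
  obtain l where l: "geometric_integrand D l" and
    S: "\<forall>\<gamma>\<in>Gam_tilde D. \<forall>\<phi>\<in>C_tilde D. (1, \<phi>) \<in> \<gamma> \<longrightarrow>
           S \<gamma> = (\<integral>\<^sup>+\<alpha>\<in>{0..1}. ennreal (l (\<phi> \<alpha>) (vector_derivative \<phi> (at \<alpha>))) \<partial>lebesgue)"
    using \<open>geometric_action D S\<close> unfolding geometric_action_def by blast
  have \<gamma>G: "\<And>n. \<gamma> n \<in> ?G" and S_lim: "(\<lambda>n. S (\<gamma> n)) \<longlonglongrightarrow> (INF \<eta>\<in>?G. S \<eta>)"
    using \<open>minimizing_sequence ?G S \<gamma>\<close> by (auto simp: minimizing_sequence_def)
  have \<gamma>Gam: "\<gamma> n \<in> Gam D" and \<gamma>c: "\<gamma> n \<in> curves D" for n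
    using \<gamma>G[of n] by (auto simp: Gam_from_to_def Gam_def)
  have "\<exists>\<psi>. (1, \<psi>) \<in> \<gamma> n \<and> (enn2real (curve_length (\<gamma> n)) + 1 / real (Suc n))-lipschitz_on {0..1} \<psi>" for n
    using rectifiable_curve_Lipschitz_param[OF \<gamma>Gam[of n], of "1 / real (Suc n)"] by auto
  then obtain \<psi> where \<psi>: "\<And>n. (1, \<psi> n) \<in> \<gamma> n"
    "\<And>n. (enn2real (curve_length (\<gamma> n)) + 1 / real (Suc n))-lipschitz_on {0..1} (\<psi> n)"
    by metis
  note \<psi>_eqs = curve_eqs[OF \<gamma>c \<psi>(1)]
  have \<psi>K: "\<psi> n ` {0..1} \<subseteq> K" for n
    using \<gamma>_K[of n] \<psi>_eqs(4)[of n] by simp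

  define L where "L = liminf (\<lambda>n. curve_length (\<gamma> n))"
  obtain r where r: "strict_mono (r :: nat \<Rightarrow> nat)" "(\<lambda>n. curve_length (\<gamma> (r n))) \<longlonglongrightarrow> L"
    using liminf_subseq_lim[of "\<lambda>n. curve_length (\<gamma> n)"] by (auto simp: L_def o_def)
  have "L \<le> (SUP n. curve_length (\<gamma> n))"
    using r(2) by (rule LIMSEQ_le_const2) (intro exI[of _ 0] allI impI SUP_upper UNIV_I)
  then have L_fin: "L < \<infinity>" using bounded_length by (rule le_less_trans)
  define \<Lambda> where "\<Lambda> = enn2real L"
  have L_eq: "ennreal \<Lambda> = L" using L_fin by (simp add: \<Lambda>_def)
  define c where "c = (\<lambda>n. enn2real (curve_length (\<gamma> (r n))) + 1 / real (Suc (r n)))"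
  have "(\<lambda>n. 1 / real (Suc n)) \<longlonglongrightarrow> 0"
    using LIMSEQ_inverse_real_of_nat by (simp add: inverse_eq_divide)
  from LIMSEQ_subseq_LIMSEQ[OF this r(1)] have "c \<longlonglongrightarrow> \<Lambda> + 0"
    unfolding c_def o_def by (intro tendsto_add tendsto_enn2real) (use r(2) L_eq in \<open>auto simp: \<Lambda>_def\<close>)
  then have c: "c \<longlonglongrightarrow> \<Lambda>" by simp
  have lip_r: "(c n)-lipschitz_on {0..1} (\<psi> (r n))" for n
    using \<psi>(2) by (simp add: c_def)

  obtain k \<phi> where k: "strict_mono (k :: nat \<Rightarrow> nat)"
    and \<phi>: "\<Lambda>-lipschitz_on {0..1} \<phi>" "\<phi> ` {0..1} \<subseteq> K"
    and conv: "\<forall>x\<in>{0..1}. (\<lambda>n. \<psi> (r (k n)) x) \<longlonglongrightarrow> \<phi> x"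
    by (rule Lipschitz_sequence_compactness[OF \<open>compact K\<close> lip_r \<psi>K c])
  have \<phi>D: "(1, \<phi>) \<in> params D"
    using \<phi> KD lipschitz_on_continuous_on by (auto simp: params_def)
  define \<gamma>' where "\<gamma>' = frechet_equiv D `` {(1, \<phi>)}"
  have \<gamma>'c: "\<gamma>' \<in> curves D"
    unfolding \<gamma>'_def curves_def using \<phi>D by (rule quotientI)
  have \<phi>_in: "(1, \<phi>) \<in> \<gamma>'"
    unfolding \<gamma>'_def using equiv_class_self[OF equiv_frechet_equiv \<phi>D] .
  note \<phi>_eqs = curve_eqs[OF \<gamma>'c \<phi>_in]
  have len: "curve_length \<gamma>' \<le> L"
    using param_length_Lipschitz[OF \<phi>(1)] by (simp add: \<phi>_eqs(3) L_eq)

  have end_in: "\<phi> x \<in> A" if "closedin (top_of_set D) A" "x \<in> {0..1}" "\<And>n. \<psi> n x \<in> A" for A x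
  proof -
    obtain Z where Z: "closed Z" "A = D \<inter> Z"
      using \<open>closedin (top_of_set D) A\<close> by (auto simp: closedin_closed)
    have "\<phi> x \<in> Z"
      using closed_sequentially[OF Z(1) _ bspec[OF conv that(2)]] that(3) Z(2) by blast
    moreover have "\<phi> x \<in> D" using \<phi>(2) KD that(2) by blast
    ultimately show ?thesis using Z(2) by blast
  qed
  have "\<phi> 0 \<in> A1"
    using \<gamma>G \<psi>_eqs(1) by (intro end_in[OF \<open>closedin (top_of_set D) A1\<close>]) (auto simp: Gam_from_to_def)
  moreover have "\<phi> 1 \<in> A2"
    using \<gamma>G \<psi>_eqs(2) by (intro end_in[OF \<open>closedin (top_of_set D) A2\<close>]) (auto simp: Gam_from_to_def)
  ultimately have \<gamma>'G: "\<gamma>' \<in> ?G"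
    using \<gamma>'c len L_fin \<phi>_eqs \<phi>(2) \<open>K \<subseteq> D'\<close> by (auto simp: Gam_from_to_def Gam_def)

  obtain C where C: "\<And>n. norm (c n) \<le> C"
    using convergent_imp_Bseq[OF convergentI[OF c]] by (auto simp: Bseq_def)
  have \<Lambda>C: "\<Lambda> \<le> C"
    by (rule LIMSEQ_le_const2[OF c]) (use C in \<open>auto simp: abs_le_iff\<close>)
  have S_eq: "S (\<gamma> n) = (\<integral>\<^sup>+\<alpha>\<in>{0..1}. ennreal (l (\<psi> n \<alpha>) (vector_derivative (\<psi> n) (at \<alpha>))) \<partial>lebesgue)" for n
    using geometric_action_eq_integral[OF S \<gamma>c \<psi>(1) \<psi>(2)] \<psi>K[of n] KD by blast
  have "strict_mono (\<lambda>n. r (k n))" using r(1) k by (simp add: strict_mono_def)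
  from LIMSEQ_subseq_LIMSEQ[OF S_lim this]
  have S_lim': "(\<lambda>n. S (\<gamma> (r (k n)))) \<longlonglongrightarrow> (INF \<eta>\<in>?G. S \<eta>)" by (simp add: o_def)
  have "S \<gamma>' = (\<integral>\<^sup>+\<alpha>\<in>{0..1}. ennreal (l (\<phi> \<alpha>) (vector_derivative \<phi> (at \<alpha>))) \<partial>lebesgue)"
    using geometric_action_eq_integral[OF S \<gamma>'c \<phi>_in \<phi>(1)] \<phi>(2) KD by blast
  also have "\<dots> \<le> (INF \<eta>\<in>?G. S \<eta>)"
  proof (rule geometric_integral_lower_semicontinuous[OF l \<open>compact K\<close> KD])
    show "C-lipschitz_on {0..1} (\<psi> (r (k n)))" for n
      using lip_r[of "k n"] by (rule lipschitz_on_le) (use C[of "k n"] in simp)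
    show "C-lipschitz_on {0..1} \<phi>"
      using \<phi>(1) \<Lambda>C by (rule lipschitz_on_le)
    show "(\<lambda>n. \<integral>\<^sup>+\<alpha>\<in>{0..1}. ennreal (l (\<psi> (r (k n)) \<alpha>) (vector_derivative (\<psi> (r (k n))) (at \<alpha>))) \<partial>lebesgue)
      \<longlonglongrightarrow> (INF \<eta>\<in>?G. S \<eta>)"
      using S_lim' by (simp only: S_eq)
  qed (use \<psi>K \<phi>(2) conv in auto)
  finally have "S \<gamma>' \<le> (INF \<eta>\<in>?G. S \<eta>)" .
  then have "strong_minimizer ?G S \<gamma>'"
    using \<gamma>'G by (auto simp: strong_minimizer_def intro!: antisym INF_lower)
  with len show ?thesis unfolding L_def by blast
qed

theorem proposition1:
  fixes D D' A1 A2 K :: "(real ^ 'n::finite) set"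
    and S :: "'n curve \<Rightarrow> ennreal"
    and \<gamma> :: "nat \<Rightarrow> 'n curve"
  assumes "open D" and "connected D"
    and "D' \<subseteq> D" and "connected D'" and "closedin (top_of_set D) D'"
    and "locally_rectifiably_connected D D'"
    and "geometric_action D S"
    and "A1 \<subseteq> D'" and "closedin (top_of_set D) A1"
    and "A2 \<subseteq> D'" and "closedin (top_of_set D) A2"
    and "compact K" and "K \<subseteq> D'"
    and "minimizing_sequence (Gam_from_to D D' A1 A2) S \<gamma>"
    and "\<And>n. curve_image (\<gamma> n) \<subseteq> K"
    and "(SUP n. curve_length (\<gamma> n)) < \<infinity>"
  shows "\<exists>\<gamma>'. strong_minimizer (Gam_from_to D D' A1 A2) S \<gamma>' \<and>
           curve_length \<gamma>' \<le> liminf (\<lambda>n. curve_length (\<gamma> n))"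
proof -
  have "K \<subseteq> D" using \<open>K \<subseteq> D'\<close> \<open>D' \<subseteq> D\<close> by (rule order_trans)
  from strong_minimizer_exists[OF \<open>geometric_action D S\<close> this assms(13,9,11,12,14-16)]
  show ?thesis .
qed

end
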